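(* Assume $d\ge5$. 1. For $\epsilon>0$ and $y>1+2\sum_{x\in\mathbb Z^d}G_d(x)^2$, $$\limsup_{n\to\infty}\frac1{\sqrt n}\log\mathbb P_0\left(\sum_{x:\,l_n(x)\le n^{1/2-\epsilon}}l_n^2(x)\ge ny\right)=-\infty .$$ 2. For $y>0$ and $\epsilon>0$, there exists a constant $\tilde c>0$ such that $$\limsup_{n\to\infty}\frac1{\sqrt n}\log\mathbb P_0\left(\sum_{x:\,l_n(x)>n^{1/2-\epsilon}}l_n^2(x)\ge ny\right)\le-\tilde c .$$
   Context: $(S_k)_{k\ge0}$ is the nearest-neighbour symmetric random walk on $\mathbb Z^d$ with $S_0=0$, with law $\mathbb P_0$ and expectation $\mathbb E_0$. Local times: $l_n(x)=\sum_{k=0}^n\mathbf 1\{S_k=x\}$, $l_\infty(x)=\sum_{k\ge0}\mathbf 1\{S_k=x\}$. Green kernel: $G_d(x)=\mathbb E_0[l_\infty(x)]$. Sums range over $x\in\mathbb Z^d$, and $\log 0=-\infty$.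
   Formalization: Part 2 is stated for 0 < ε < 1/2 instead of all ε > 0; for ε > 1/2 and 0 < y ≤ 1 the sum runs over all visited sites and is at least n+1 ≥ ny, so the probability is 1 and the claimed bound fails. *)

theory Defs
  imports "HOL-Probability.Probability"
begin

definition unit_steps :: "(int ^ 'd::finite) set" where
  "unit_steps = {axis i s | i s. s \<in> {1, -1}}"

text \<open>A sample point is the sequence of steps of the walk; the steps are independent and uniform.\<close>

definition srw_measure :: "(nat \<Rightarrow> int ^ 'd::finite) measure" where
  "srw_measure = (\<Pi>\<^sub>M k\<in>UNIV. measure_pmf (pmf_of_set unit_steps))"

definition walk :: "(nat \<Rightarrow> int ^ 'd::finite) \<Rightarrow> nat \<Rightarrow> int ^ 'd" where
  "walk \<omega> n = (\<Sum>k<n. \<omega> k)"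

definition local_time :: "(nat \<Rightarrow> int ^ 'd::finite) \<Rightarrow> nat \<Rightarrow> int ^ 'd \<Rightarrow> nat" where
  "local_time \<omega> n x = (\<Sum>k\<le>n. of_bool (walk \<omega> k = x))"

definition total_local_time :: "(nat \<Rightarrow> int ^ 'd::finite) \<Rightarrow> int ^ 'd \<Rightarrow> ennreal" where
  "total_local_time \<omega> x = (\<Sum>k. of_bool (walk \<omega> k = x))"

definition green :: "int ^ 'd::finite \<Rightarrow> ennreal" where
  "green x = (\<integral>\<^sup>+ \<omega>. total_local_time \<omega> x \<partial>srw_measure)"

text \<open>Logarithm of a probability, with the convention that the logarithm of zero is minus infinity
  (the library has \<^term>\<open>ln (0::real) = 0\<close>).\<close>

definition ext_ln :: "real \<Rightarrow> ereal" where
  "ext_ln p = (if p = 0 then -\<infinity> else ereal (ln p))"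

text \<open>The set \<open>A\<close> may be infinite, hence \<^const>\<open>infsum\<close>; only finitely many terms are nonzero.\<close>

definition sq_local_time :: "(nat \<Rightarrow> int ^ 'd::finite) \<Rightarrow> nat \<Rightarrow> (int ^ 'd) set \<Rightarrow> real" where
  "sq_local_time \<omega> n A = (\<Sum>\<^sub>\<infinity>x\<in>A. (real (local_time \<omega> n x))\<^sup>2)"

end

theory Submission
  imports Defs
begin

text \<open>Let \<open>G\<close> be the Green kernel. Its squares have sum \<open>\<Sum>n. (n + 1) p n\<close>, where the return
  probabilities satisfy \<open>p n = O(n^(-d/2))\<close>, so this is finite for \<open>d \<ge> 5\<close>. For a nondecreasing \<open>h\<close> with
  \<open>h 0 = 0\<close> and increments at most 1, consider the potential \<open>\<Phi> = \<Sum>x. h (l x) G (S - x)\<close> of the current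
  local time profile \<open>l\<close>, seen from the current position \<open>S\<close>. Since \<open>G\<close> is harmonic off the origin,
  visiting \<open>S\<close> and making one step changes \<open>\<Phi>\<close> on average by exactly
  \<open>G 0 (h (l S + 1) - h (l S)) - h (l S + 1)\<close>. Hence \<open>\<Phi>\<close> compensates the additive functional that
  collects \<open>\<kappa> h (l S + 1)\<close> at each visit, and its exponential moments of order \<open>\<alpha>\<close> are under control
  as long as \<open>\<alpha> \<Phi>\<close> stays below 1.
  The Cauchy--Schwarz inequality bounds \<open>\<Phi>\<close> by \<open>\<parallel>G\<parallel> (\<Sum>x. h (l x)^2)^(1/2)\<close>, which is \<open>O(n^(1/2))\<close> before
  the functional gets of order \<open>n\<close>.

  For the low levels take \<open>h l = min l M\<close> with \<open>M = n^(1/2-\<epsilon>)\<close>: splitting off finitely many sites,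
  where \<open>h \<le> M\<close>, improves the bound to \<open>\<Phi> = o(n^(1/2))\<close>, so \<open>\<alpha> = K / n^(1/2)\<close> is admissible for every \<open>K\<close>.
  For the high levels take \<open>h l = max (l - M / 2) (\<delta> l)\<close> with a small slope \<open>\<delta>\<close>, so that the functional
  has a drift of only \<open>\<delta> G 0\<close> per step, and \<open>\<alpha>\<close> a small multiple of \<open>n^(-1/2)\<close>.\<close>

section \<open>Return probabilities of the walk\<close>

definition step_avg :: "(int ^ 'd::finite \<Rightarrow> real) \<Rightarrow> real" where
  "step_avg g = (\<Sum>s\<in>unit_steps. g s) / (2 * real CARD('d))"

text \<open>Defined by recursion over the steps, without the measure; \<open>prob_walk_eq\<close>
  identifies it with the law of \<open>walk\<close>.\<close>

primrec step_prob :: "nat \<Rightarrow> int ^ 'd::finite \<Rightarrow> real" where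
  "step_prob 0 x = of_bool (x = 0)"
| "step_prob (Suc n) x = step_avg (\<lambda>s. step_prob n (x - s))"

primrec line_walks :: "nat \<Rightarrow> int \<Rightarrow> real" where
  "line_walks 0 t = of_bool (t = 0)"
| "line_walks (Suc n) t = line_walks n (t - 1) + line_walks n (t + 1)"

text \<open>Counts the paths from the origin to \<open>x\<close> whose steps all lie along axes in
  \<open>J\<close>. The set \<open>J\<close> permits an induction on the dimension inside one fixed
  type.\<close>

primrec axis_walks :: "'d set \<Rightarrow> nat \<Rightarrow> int ^ 'd::finite \<Rightarrow> real" where
  "axis_walks J 0 x = of_bool (x = 0)"
| "axis_walks J (Suc n) x =
    (\<Sum>i\<in>J. axis_walks J n (x - axis i 1) + axis_walks J n (x - axis i (- 1)))"

lemma unit_steps_eq: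
  "unit_steps = (\<lambda>i. axis i 1) ` UNIV \<union> (\<lambda>i. axis i (- 1)) ` (UNIV :: 'd::finite set)"
  unfolding unit_steps_def by auto

lemma axis_int_eq_iff:
  "axis i s = (axis j t :: int ^ 'd::finite) \<longleftrightarrow> (i = j \<and> s = t) \<or> (s = 0 \<and> t = 0)"
  by (auto simp: axis_eq_axis)

lemma sum_unit_steps:
  fixes g :: "int ^ 'd::finite \<Rightarrow> 'a::comm_monoid_add"
  shows "(\<Sum>s\<in>unit_steps. g s) = (\<Sum>i\<in>UNIV. g (axis i 1) + g (axis i (- 1)))"
proof -
  have "(\<Sum>s\<in>unit_steps. g s)
      = sum g ((\<lambda>i. axis i 1) ` (UNIV :: 'd set)) + sum g ((\<lambda>i. axis i (- 1)) ` (UNIV :: 'd set))"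
    unfolding unit_steps_eq by (rule sum.union_disjoint) (auto simp: axis_int_eq_iff)
  also have "\<dots> = (\<Sum>i\<in>UNIV. g (axis i 1)) + (\<Sum>i\<in>UNIV. g (axis i (- 1)))"
    by (subst (1 2) sum.reindex) (auto simp: axis_int_eq_iff inj_on_def)
  finally show ?thesis by (simp add: sum.distrib)
qed

lemma finite_unit_steps: "finite (unit_steps :: (int ^ 'd::finite) set)"
  unfolding unit_steps_eq by auto

lemma unit_steps_nonempty: "unit_steps \<noteq> ({} :: (int ^ 'd::finite) set)"
  unfolding unit_steps_eq by auto

lemma card_unit_steps: "card (unit_steps :: (int ^ 'd::finite) set) = 2 * CARD('d)"
  using sum_unit_steps[of "\<lambda>_ :: int ^ 'd. 1 :: nat"] by simp

lemma sum_unit_steps_uminus: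
  fixes g :: "int ^ 'd::finite \<Rightarrow> 'a::comm_monoid_add"
  shows "(\<Sum>s\<in>unit_steps. g (- s)) = (\<Sum>s\<in>unit_steps. g s)"
proof -
  have "- axis i s = axis i (- s)" for i :: 'd and s :: int
    by (vector axis_def)
  then show ?thesis
    unfolding sum_unit_steps by (simp add: add.commute)
qed

section \<open>Path counts on the line and the central binomial coefficient\<close>

lemma line_walks_outside: "\<bar>t\<bar> > int n \<Longrightarrow> line_walks n t = 0"
  by (induction n arbitrary: t) auto

lemma line_walks_parity: "odd (int n + t) \<Longrightarrow> line_walks n t = 0"
  by (induction n arbitrary: t) auto

lemma line_walks_binomial: "line_walks n (2 * int j - int n) = real (n choose j)"
proof (induction n arbitrary: j)
  case (Suc n)
  show ?case
  proof (cases j)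
    case 0
    then show ?thesis
      using Suc[of 0] line_walks_outside[of n "- int n - 2"] by (simp add: algebra_simps)
  next
    case (Suc k)
    have "line_walks n (2 * int j - int (Suc n) - 1) = real (n choose k)"
      using Suc.IH[of k] Suc by (simp add: algebra_simps)
    moreover have "line_walks n (2 * int j - int (Suc n) + 1) = real (n choose j)"
      using Suc.IH[of j] by (simp add: algebra_simps)
    ultimately show ?thesis using Suc by simp
  qed
qed auto

text \<open>Consecutive central binomial coefficients have quotient
  \<open>2 (2 j + 1) / (j + 1)\<close>, so the induction step amounts to
  \<open>(2 j + 1) (2 j + 3) \<le> (2 j + 2)^2\<close>. The squared form avoids roots.\<close>

lemma central_binomial_upper: "(real (2 * j choose j))\<^sup>2 * (2 * real j + 1) \<le> 16 ^ j"
proof (induction j)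
  case (Suc j)
  define c where "c = real (2 * j choose j)"
  have "Suc j * (2 * Suc j choose Suc j) = (2 * Suc j) * (Suc (2 * j) choose j)"
    using Suc_times_binomial_eq[of "Suc (2*j)" j] by (simp add: mult.commute)
  moreover have "Suc j * (Suc (2 * j) choose j) = Suc (2 * j) * (2 * j choose j)"
    using Suc_times_binomial_eq[of "2*j" j] binomial_symmetric[of j "Suc (2*j)"]
    by (simp add: mult.commute)
  ultimately have "Suc j * (2 * Suc j choose Suc j) = 2 * (Suc (2 * j) * (2 * j choose j))"
    by (metis mult.assoc)
  then have "real (Suc j * (2 * Suc j choose Suc j)) = real (2 * (Suc (2 * j) * (2 * j choose j)))"
    by (rule arg_cong)
  then have e: "(real j + 1) * real (2 * Suc j choose Suc j) = 2 * (2 * real j + 1) * c"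
    unfolding c_def by (simp only: of_nat_mult of_nat_Suc of_nat_numeral) (simp add: algebra_simps)
  have "(real j + 1)\<^sup>2 * ((real (2 * Suc j choose Suc j))\<^sup>2 * (2 * real (Suc j) + 1))
      = (2 * (2 * real j + 1) * c)\<^sup>2 * (2 * real j + 3)"
    unfolding e[symmetric] by (simp add: power_mult_distrib)
  also have "\<dots> = (4 * (2 * real j + 1) * (2 * real j + 3)) * (c\<^sup>2 * (2 * real j + 1))"
    by (simp add: power2_eq_square algebra_simps)
  also have "\<dots> \<le> (16 * (real j + 1)\<^sup>2) * 16 ^ j"
  proof (rule mult_mono)
    show "4 * (2 * real j + 1) * (2 * real j + 3) \<le> 16 * (real j + 1)\<^sup>2"
      by (simp add: power2_eq_square algebra_simps)
    show "c\<^sup>2 * (2 * real j + 1) \<le> 16 ^ j" using Suc unfolding c_def .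
  qed auto
  also have "\<dots> = (real j + 1)\<^sup>2 * 16 ^ Suc j" by simp
  finally show ?case by (rule mult_left_le_imp_le) auto
qed auto

lemma line_walks_zero_le: "line_walks m 0 \<le> 2 ^ m / sqrt (real m + 1)"
proof (cases "even m")
  case True
  then obtain j where m: "m = 2 * j" by auto
  have eq: "line_walks m 0 = real (2 * j choose j)"
    using line_walks_binomial[of m j] m by simp
  have "(line_walks m 0 * sqrt (real m + 1))\<^sup>2 \<le> (2 ^ m)\<^sup>2"
  proof -
    have "((2::real) ^ m)\<^sup>2 = 16 ^ j"
      by (simp add: m power_mult power2_eq_square flip: power_mult_distrib)
    moreover have "(line_walks m 0 * sqrt (real m + 1))\<^sup>2
        = (real (2 * j choose j))\<^sup>2 * (2 * real j + 1)"
      unfolding eq by (simp add: m power_mult_distrib)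
    ultimately show ?thesis using central_binomial_upper[of j] by simp
  qed
  then have "line_walks m 0 * sqrt (real m + 1) \<le> 2 ^ m"
    by (rule power2_le_imp_le) simp
  then show ?thesis by (simp add: field_simps)
qed (simp add: line_walks_parity)

text \<open>A Leibniz rule: by Pascal's rule, raising the degree of a binomial convolution shifts
  either one factor or the other.\<close>

lemma binomial_convolution_Suc:
  fixes f g :: "nat \<Rightarrow> real"
  shows "(\<Sum>m\<le>Suc n. real (Suc n choose m) * f m * g (Suc n - m))
    = (\<Sum>m\<le>n. real (n choose m) * f (Suc m) * g (n - m))
      + (\<Sum>m\<le>n. real (n choose m) * f m * g (Suc (n - m)))"
proof -
  have "(\<Sum>m\<le>n. real (n choose m) * f m * g (Suc (n - m)))
      = (\<Sum>m\<le>Suc n. real (n choose m) * f m * g (Suc n - m))"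
    by (simp add: Suc_diff_le)
  also have "\<dots> = f 0 * g (Suc n) + (\<Sum>m\<le>n. real (n choose Suc m) * f (Suc m) * g (n - m))"
    by (subst sum.atMost_Suc_shift) simp
  finally have e: "(\<Sum>m\<le>n. real (n choose m) * f m * g (Suc (n - m)))
      = f 0 * g (Suc n) + (\<Sum>m\<le>n. real (n choose Suc m) * f (Suc m) * g (n - m))" .
  show ?thesis
    unfolding e by (subst sum.atMost_Suc_shift) (simp add: algebra_simps sum.distrib)
qed

lemma axis_walks_nonneg: "0 \<le> axis_walks J n x"
  by (induction n arbitrary: x) (auto intro!: sum_nonneg)

text \<open>Choose which \<open>m\<close> of the \<open>n\<close> steps go along axis
  \<open>i\<close>: they form a path on the line, and the others a path along \<open>J\<close>. In
  the induction, one more step lengthens one of the two paths, which is the Leibniz rule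
  above.\<close>

lemma axis_walks_insert:
  assumes "i \<notin> J"
  shows "axis_walks (insert i J) n x = (\<Sum>m\<le>n. real (n choose m) * line_walks m (x $ i)
    * axis_walks J (n - m) (x - axis i (x $ i)))"
proof (induction n arbitrary: x)
  case 0
  have "x = 0 \<longleftrightarrow> x $ i = 0 \<and> x - axis i (x $ i) = 0" by auto
  then show ?case by auto
next
  case (Suc n)
  define u where "u = x - axis i (x $ i)"
  have i: "(x - axis i s) $ i = x $ i - s" "x - axis i s - axis i (x $ i - s) = u" for s
    unfolding u_def by (auto simp: vec_eq_iff axis_def)
  have k: "(x - axis k s) $ i = x $ i" "x - axis k s - axis i (x $ i) = u - axis k s"
    if "k \<in> J" for k s
    using that assms unfolding u_def by (auto simp: vec_eq_iff axis_def)
  have wi: "axis_walks (insert i J) n (x - axis i s)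
      = (\<Sum>m\<le>n. real (n choose m) * line_walks m (x $ i - s) * axis_walks J (n - m) u)" for s
    by (simp only: Suc i)
  have wk: "axis_walks (insert i J) n (x - axis k s)
      = (\<Sum>m\<le>n. real (n choose m) * line_walks m (x $ i) * axis_walks J (n - m) (u - axis k s))"
    if "k \<in> J" for k s
    by (simp only: Suc k[OF that])
  have "axis_walks (insert i J) (Suc n) x
      = (\<Sum>m\<le>n. real (n choose m) * line_walks m (x $ i - 1) * axis_walks J (n - m) u)
      + (\<Sum>m\<le>n. real (n choose m) * line_walks m (x $ i + 1) * axis_walks J (n - m) u)
      + (\<Sum>j\<in>J. (\<Sum>m\<le>n. real (n choose m) * line_walks m (x $ i) * axis_walks J (n - m) (u - axis j 1))
      + (\<Sum>m\<le>n. real (n choose m) * line_walks m (x $ i) * axis_walks J (n - m) (u - axis j (- 1))))"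
    using assms by (simp add: wi wk)
  also have "(\<Sum>j\<in>J. (\<Sum>m\<le>n. real (n choose m) * line_walks m (x $ i) * axis_walks J (n - m) (u - axis j 1))
      + (\<Sum>m\<le>n. real (n choose m) * line_walks m (x $ i) * axis_walks J (n - m) (u - axis j (- 1))))
      = (\<Sum>m\<le>n. real (n choose m) * line_walks m (x $ i) * axis_walks J (Suc (n - m)) u)"
    unfolding sum.distrib[symmetric]
    by (subst sum.swap) (simp add: sum_distrib_left algebra_simps)
  also have "(\<Sum>m\<le>n. real (n choose m) * line_walks m (x $ i - 1) * axis_walks J (n - m) u)
      + (\<Sum>m\<le>n. real (n choose m) * line_walks m (x $ i + 1) * axis_walks J (n - m) u)
      = (\<Sum>m\<le>n. real (n choose m) * line_walks (Suc m) (x $ i) * axis_walks J (n - m) u)"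
    unfolding sum.distrib[symmetric] by (simp add: algebra_simps)
  finally show ?case
    unfolding u_def
      binomial_convolution_Suc[of n "\<lambda>m. line_walks m (x $ i)" "\<lambda>m. axis_walks J m (x - axis i (x $ i))"] .
qed

text \<open>The multinomial convolution of the weights \<open>1 / (m! sqrt (m + 1))\<close> is split by
  Cauchy--Schwarz into those of \<open>1 / m!\<close> and of \<open>1 / (m + 1)!\<close>, both of which are binomial sums.\<close>

lemma axis_walks_return_le:
  fixes J :: "'d::finite set"
  shows "(axis_walks J n 0 / (fact n * 2 ^ n))\<^sup>2
    \<le> real (card J) ^ n / fact n * (real (card J) ^ (n + card J) / fact (n + card J))"
proof -
  have "finite J" by simp
  then show ?thesis
  proof (induction J arbitrary: n)
    case empty
    show ?case by (cases n) auto
  next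
    case (insert i J)
    define r where "r = card J"
    define \<alpha> where "\<alpha> k = real r ^ k / fact k" for k
    define v where "v k = axis_walks J k 0 / (fact k * 2 ^ k)" for k
    have v0: "0 \<le> v k" for k unfolding v_def by (simp add: axis_walks_nonneg)
    have v: "v k \<le> sqrt (\<alpha> k) * sqrt (\<alpha> (k + r))" for k
      unfolding real_sqrt_mult[symmetric] v_def \<alpha>_def r_def by (rule real_le_rsqrt[OF insert.IH])
    have a0: "0 \<le> \<alpha> k" for k unfolding \<alpha>_def by simp
    define f where "f m = sqrt (1 / fact m) * sqrt (\<alpha> (n - m))" for m
    define g where "g m = sqrt (1 / fact (Suc m)) * sqrt (\<alpha> (n - m + r))" for m
    have "axis_walks (insert i J) n 0 / (fact n * 2 ^ n)
        = (\<Sum>m\<le>n. real (n choose m) * line_walks m 0 * axis_walks J (n - m) 0) / (fact n * 2 ^ n)"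
    proof -
      have "axis i 0 = (0 :: int ^ 'd)" by (simp add: vec_eq_iff axis_def)
      from axis_walks_insert[OF insert.hyps(2), of n 0, unfolded zero_index this]
      show ?thesis by simp
    qed
    also have "\<dots> = (\<Sum>m\<le>n. line_walks m 0 / (fact m * 2 ^ m) * v (n - m))"
      unfolding sum_divide_distrib v_def
    proof (intro sum.cong refl)
      fix m assume "m \<in> {..n}"
      then have "real (n choose m) = fact n / (fact m * fact (n - m))" "(2::real) ^ n = 2 ^ m * 2 ^ (n - m)"
        by (auto simp: binomial_fact simp flip: power_add)
      then show "real (n choose m) * line_walks m 0 * axis_walks J (n - m) 0 / (fact n * 2 ^ n)
          = line_walks m 0 / (fact m * 2 ^ m) * (axis_walks J (n - m) 0 / (fact (n - m) * 2 ^ (n - m)))"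
        by simp
    qed
    also have "\<dots> \<le> (\<Sum>m\<le>n. f m * g m)"
    proof (intro sum_mono)
      fix m assume "m \<in> {..n}"
      have "line_walks m 0 / (fact m * 2 ^ m) \<le> (2 ^ m / sqrt (real m + 1)) / (fact m * 2 ^ m)"
        by (intro divide_right_mono line_walks_zero_le) auto
      also have "\<dots> = 1 / (fact m * sqrt (real m + 1))" by (simp add: field_simps)
      also have "\<dots> = sqrt (1 / fact m) * sqrt (1 / fact (Suc m))"
      proof -
        have "1 / fact m * (1 / fact (Suc m)) = (1 / fact m)\<^sup>2 * (1 / (real m + 1))"
          by (simp add: power2_eq_square add.commute)
        then have "sqrt (1 / fact m * (1 / fact (Suc m))) = 1 / fact m * (1 / sqrt (real m + 1))"
          by (simp only: real_sqrt_mult real_sqrt_divide real_sqrt_one real_sqrt_abs) simp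
        then show ?thesis by (simp only: real_sqrt_mult) simp
      qed
      finally have "line_walks m 0 / (fact m * 2 ^ m) * v (n - m)
          \<le> (sqrt (1 / fact m) * sqrt (1 / fact (Suc m))) * (sqrt (\<alpha> (n - m)) * sqrt (\<alpha> (n - m + r)))"
        by (intro mult_mono v v0) auto
      then show "line_walks m 0 / (fact m * 2 ^ m) * v (n - m) \<le> f m * g m"
        unfolding f_def g_def by (simp add: ac_simps)
    qed
    finally have le: "axis_walks (insert i J) n 0 / (fact n * 2 ^ n) \<le> (\<Sum>m\<le>n. f m * g m)" .
    have bin: "(\<Sum>m\<le>k. 1 / fact m * \<alpha> (k - m)) = real (Suc r) ^ k / fact k" for k
    proof -
      have "real (Suc r) ^ k = (\<Sum>m\<le>k. real (k choose m) * 1 ^ m * real r ^ (k - m))"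
        using binomial_ring[of 1 "real r" k] by simp
      also have "\<dots> / fact k = (\<Sum>m\<le>k. 1 / fact m * \<alpha> (k - m))"
        unfolding sum_divide_distrib \<alpha>_def by (intro sum.cong refl) (auto simp: binomial_fact)
      finally show ?thesis by simp
    qed
    have f: "(\<Sum>m\<le>n. (f m)\<^sup>2) = real (Suc r) ^ n / fact n"
      unfolding f_def bin[symmetric] by (simp add: power_mult_distrib a0)
    \<comment> \<open>Shifting \<open>m\<close> by one turns this into part of the binomial sum of
      degree \<open>n + r + 1\<close>, which is where the exponent \<open>n + card J\<close> gains
      one for the new axis.\<close>
    have "(\<Sum>m\<le>n. (g m)\<^sup>2) = (\<Sum>m\<le>n. 1 / fact (Suc m) * \<alpha> (Suc n + r - Suc m))"
      unfolding g_def power_mult_distrib by (intro sum.cong refl) (auto simp: a0)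
    also have "\<dots> = (\<Sum>m\<in>Suc ` {..n}. 1 / fact m * \<alpha> (Suc n + r - m))"
      by (subst sum.reindex) auto
    also have "\<dots> \<le> (\<Sum>m\<le>Suc n + r. 1 / fact m * \<alpha> (Suc n + r - m))"
      by (intro sum_mono2) (auto simp: a0)
    also have "\<dots> = real (Suc r) ^ (n + Suc r) / fact (n + Suc r)"
      unfolding bin by simp
    finally have g: "(\<Sum>m\<le>n. (g m)\<^sup>2) \<le> real (Suc r) ^ (n + Suc r) / fact (n + Suc r)" .
    have "(axis_walks (insert i J) n 0 / (fact n * 2 ^ n))\<^sup>2 \<le> (\<Sum>m\<le>n. f m * g m)\<^sup>2"
      using le by (intro power_mono) (auto simp: axis_walks_nonneg)
    also have "\<dots> \<le> (\<Sum>m\<le>n. (f m)\<^sup>2) * (\<Sum>m\<le>n. (g m)\<^sup>2)"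
      by (rule Cauchy_Schwarz_ineq_sum)
    also have "\<dots> \<le> real (Suc r) ^ n / fact n * (real (Suc r) ^ (n + Suc r) / fact (n + Suc r))"
      unfolding f by (intro mult_left_mono g) auto
    finally show ?case
      using insert.hyps by (simp add: r_def)
  qed
qed

lemma step_prob_eq_axis_walks:
  fixes x :: "int ^ 'd::finite"
  shows "step_prob n x = axis_walks UNIV n x / (2 * real CARD('d)) ^ n"
proof (induction n arbitrary: x)
  case (Suc n)
  show ?case
    by (simp add: step_avg_def sum_unit_steps Suc mult.commute flip: add_divide_distrib sum_divide_distrib)
qed auto

text \<open>After normalisation the path count leaves \<open>n! / (n + d)!\<close>, at most
  \<open>(n + 1)^(-d)\<close>. Keeping only the exponent 5 yields return probabilities of order
  \<open>n^(-5/2)\<close>.\<close>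

lemma step_prob_zero_le:
  assumes "CARD('d::finite) \<ge> 5"
  shows "(step_prob n (0 :: int ^ 'd))\<^sup>2 \<le> real CARD('d) ^ CARD('d) / real (Suc n) ^ 5"
proof -
  define D where "D = CARD('d)"
  have D: "D > 0" "D \<ge> 5" using assms unfolding D_def by auto
  have le: "fact n * real (Suc n) ^ 5 \<le> fact (n + D)"
  proof -
    have "fact n * Suc n ^ k \<le> (fact (n + k) :: nat)" for k
    proof (induction k)
      case (Suc k)
      have "fact n * Suc n ^ Suc k = Suc n * (fact n * Suc n ^ k)" by (simp only: power_Suc ac_simps)
      also have "\<dots> \<le> Suc (n + k) * fact (n + k)" using Suc by (intro mult_mono) auto
      finally show ?case by simp
    qed simp
    then have "fact n * Suc n ^ D \<le> (fact (n + D) :: nat)" .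
    moreover have "Suc n ^ 5 \<le> Suc n ^ D" using D by (intro power_increasing) auto
    ultimately have "fact n * Suc n ^ 5 \<le> (fact (n + D) :: nat)"
      by (meson le_trans mult_le_mono2)
    then have "real (fact n * Suc n ^ 5) \<le> real (fact (n + D))"
      by (simp only: of_nat_le_iff)
    then show ?thesis by (simp del: of_nat_Suc)
  qed
  have "(step_prob n (0 :: int ^ 'd))\<^sup>2
      = (axis_walks (UNIV :: 'd set) n 0 / (fact n * 2 ^ n))\<^sup>2 * ((fact n)\<^sup>2 / real D ^ (2 * n))"
    unfolding step_prob_eq_axis_walks D_def[symmetric] using D
    by (simp add: power_mult_distrib power_divide power_mult field_simps)
  also have "\<dots> \<le> (real D ^ n / fact n * (real D ^ (n + D) / fact (n + D)))
      * ((fact n)\<^sup>2 / real D ^ (2 * n))"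
    using axis_walks_return_le[of "UNIV :: 'd set" n] unfolding D_def
    by (intro mult_right_mono) auto
  also have "\<dots> = real D ^ D * (fact n / fact (n + D))"
    using D by (simp add: power_add power2_eq_square mult_2)
  also have "\<dots> \<le> real D ^ D * (1 / real (Suc n) ^ 5)"
    using le by (intro mult_left_mono) (auto simp: field_simps)
  finally show ?thesis unfolding D_def by simp
qed

section \<open>Square summability of the Green kernel\<close>

lemma step_avg_mono: "(\<And>s. g s \<le> g' s) \<Longrightarrow> step_avg g \<le> step_avg g'"
  unfolding step_avg_def by (intro divide_right_mono sum_mono) auto

lemma step_avg_const: "step_avg (\<lambda>_ :: int ^ 'd::finite. a) = a"
  unfolding step_avg_def by (simp add: card_unit_steps)

lemma step_avg_uminus: "step_avg (\<lambda>s. g (- s)) = step_avg g"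
  unfolding step_avg_def by (simp add: sum_unit_steps_uminus)

lemma step_avg_add: "step_avg (\<lambda>s. g s + g' s) = step_avg g + step_avg g'"
  unfolding step_avg_def by (simp add: sum.distrib add_divide_distrib)

lemma step_avg_cmult: "step_avg (\<lambda>s. a * g s) = a * step_avg g"
  unfolding step_avg_def by (simp add: sum_distrib_left)

lemma step_avg_sum: "step_avg (\<lambda>s. \<Sum>x\<in>D. g x s) = (\<Sum>x\<in>D. step_avg (g x))"
  unfolding step_avg_def by (subst sum.swap) (simp add: sum_divide_distrib)

lemma step_avg_suminf:
  assumes "\<And>s. summable (\<lambda>n. g n s)"
  shows "step_avg (\<lambda>s. \<Sum>n. g n s) = (\<Sum>n. step_avg (g n))"
  unfolding step_avg_def using assms
  by (simp add: suminf_sum suminf_divide summable_sum)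

lemma step_prob_nonneg: "0 \<le> step_prob n x"
  unfolding step_prob_eq_axis_walks by (simp add: axis_walks_nonneg)

lemma step_prob_uminus: "step_prob n (- x) = step_prob n x"
proof (induction n arbitrary: x)
  case (Suc n)
  have "step_prob (Suc n) (- x) = step_avg (\<lambda>s. step_prob n (- (x - (- s))))"
    by simp
  also have "\<dots> = step_prob (Suc n) x"
    unfolding Suc using step_avg_uminus[of "\<lambda>s. step_prob n (x - s)"] by simp
  finally show ?case .
qed auto

text \<open>The Chapman--Kolmogorov equation, truncated to a finite set \<open>R\<close> of
  intermediate points so that no infinite sum over the lattice occurs.\<close>

lemma step_prob_convolution_le:
  assumes "finite R"
  shows "(\<Sum>x\<in>R. step_prob j x * step_prob k (z - x)) \<le> step_prob (j + k) z"
  using assms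
proof (induction j arbitrary: R z)
  case 0
  have "(\<Sum>x\<in>R. step_prob 0 x * step_prob k (z - x))
      = (\<Sum>x\<in>R. if x = 0 then step_prob k z else 0)"
    by (intro sum.cong) auto
  then show ?case using 0 by (simp add: step_prob_nonneg)
next
  case (Suc j)
  have "(\<Sum>x\<in>R. step_prob (Suc j) x * step_prob k (z - x))
      = step_avg (\<lambda>s. \<Sum>x\<in>R. step_prob k (z - x) * step_prob j (x - s))"
    by (simp add: step_avg_sum step_avg_cmult) (simp add: mult.commute)
  also have "\<dots> \<le> step_avg (\<lambda>s. step_prob (j + k) (z - s))"
  proof (rule step_avg_mono)
    fix s
    have "(\<Sum>x\<in>R. step_prob k (z - x) * step_prob j (x - s))
        = (\<Sum>x\<in>(\<lambda>x. x - s) ` R. step_prob j x * step_prob k (z - s - x))"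
      by (subst sum.reindex) (auto simp: inj_on_def algebra_simps)
    also have "\<dots> \<le> step_prob (j + k) (z - s)" using Suc by simp
    finally show "(\<Sum>x\<in>R. step_prob k (z - x) * step_prob j (x - s)) \<le> step_prob (j + k) (z - s)" .
  qed
  finally show ?case by simp
qed

lemma step_prob_inner_le:
  fixes R :: "(int ^ 'd::finite) set"
  assumes "finite R"
  shows "(\<Sum>x\<in>R. step_prob j x * step_prob k x) \<le> step_prob (j + k) (0 :: int ^ 'd)"
  using step_prob_convolution_le[OF assms, of j k 0] by (simp add: step_prob_uminus)

text \<open>The decay \<open>n^(-5/2)\<close> of the return probabilities leaves terms of order
  \<open>n^(-3/2)\<close>.\<close>

lemma summable_return_prob:
  assumes "CARD('d::finite) \<ge> 5"
  shows "summable (\<lambda>n. real (Suc n) * step_prob n (0 :: int ^ 'd))"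
proof (rule summable_comparison_test')
  define C where "C = sqrt (real CARD('d) ^ CARD('d))"
  have "summable (\<lambda>n. real n powr (- 3 / 2))" by (subst summable_real_powr_iff) simp
  then show "summable (\<lambda>n. C * real (Suc n) powr (- 3 / 2))"
    by (intro summable_mult) (simp only: summable_Suc_iff[of "\<lambda>n. real n powr (- 3 / 2)"])
  fix n :: nat assume "0 \<le> n"
  have "step_prob n (0 :: int ^ 'd) \<le> sqrt (real CARD('d) ^ CARD('d) / real (Suc n) ^ 5)"
    using assms by (intro real_le_rsqrt step_prob_zero_le)
  also have "\<dots> = C * real (Suc n) powr (- 5 / 2)"
  proof -
    have "sqrt (real (Suc n) ^ 5) = (real (Suc n) powr 5) powr (1 / 2)"
      by (subst powr_half_sqrt) (simp_all flip: powr_numeral)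
    also have "\<dots> = real (Suc n) powr (5 / 2)" by (subst powr_powr) simp
    finally show ?thesis
      unfolding C_def real_sqrt_divide by (simp only: minus_divide_left[symmetric] powr_minus_divide) simp
  qed
  finally have "real (Suc n) * step_prob n (0 :: int ^ 'd)
      \<le> real (Suc n) powr 1 * (C * real (Suc n) powr (- 5 / 2))"
    by (subst powr_one) (auto intro!: mult_left_mono)
  also have "\<dots> = C * (real (Suc n) powr 1 * real (Suc n) powr (- 5 / 2))"
    by (simp only: ac_simps)
  also have "\<dots> = C * real (Suc n) powr (- 3 / 2)"
    by (subst powr_add[symmetric]) simp
  finally show "norm (real (Suc n) * step_prob n (0 :: int ^ 'd)) \<le> C * real (Suc n) powr (- 3 / 2)"
    by (simp add: step_prob_nonneg)
qed

text \<open>Each \<open>n\<close> is a sum \<open>j + k\<close> in at most \<open>n + 1\<close>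
  ways.\<close>

lemma sum_sum_add_le:
  fixes q :: "nat \<Rightarrow> real"
  assumes "\<And>n. 0 \<le> q n"
  shows "(\<Sum>j<T. \<Sum>k<T. q (j + k)) \<le> (\<Sum>n<2 * T. real (Suc n) * q n)"
proof -
  have "(\<Sum>j<T. \<Sum>k<T. q (j + k)) \<le> (\<Sum>j<T. \<Sum>n<2 * T. of_bool (j \<le> n) * q n)"
  proof (rule sum_mono)
    fix j assume j: "j \<in> {..<T}"
    have "(\<Sum>k<T. q (j + k)) = (\<Sum>n\<in>(\<lambda>k. j + k) ` {..<T}. of_bool (j \<le> n) * q n)"
      by (subst sum.reindex) auto
    also have "\<dots> \<le> (\<Sum>n<2 * T. of_bool (j \<le> n) * q n)"
      using j assms by (intro sum_mono2) auto
    finally show "(\<Sum>k<T. q (j + k)) \<le> (\<Sum>n<2 * T. of_bool (j \<le> n) * q n)" .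
  qed
  also have "\<dots> = (\<Sum>n<2 * T. real (card ({..<T} \<inter> {j. j \<le> n})) * q n)"
    by (subst sum.swap) (simp flip: sum_distrib_right)
  also have "\<dots> \<le> (\<Sum>n<2 * T. real (Suc n) * q n)"
  proof (intro sum_mono mult_right_mono assms)
    fix n
    have "card ({..<T} \<inter> {j. j \<le> n}) \<le> card {..n}" by (intro card_mono) auto
    then show "real (card ({..<T} \<inter> {j. j \<le> n})) \<le> real (Suc n)" by simp
  qed
  finally show ?thesis .
qed

definition green_real :: "int ^ 'd::finite \<Rightarrow> real" where
  "green_real x = (\<Sum>n. step_prob n x)"

text \<open>An upper bound for the sum of the squared Green kernel over any finite set of sites; the
  argument only carries the dimension.\<close>

definition green_sq_bound :: "'d::finite itself \<Rightarrow> real" where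
  "green_sq_bound _ = (\<Sum>n. real (Suc n) * step_prob n (0 :: int ^ 'd))"

context
  assumes dim: "CARD('d::finite) \<ge> 5"
begin

lemma green_sq_bound_nonneg: "0 \<le> green_sq_bound TYPE('d)"
  unfolding green_sq_bound_def
  by (intro suminf_nonneg summable_return_prob dim) (simp add: step_prob_nonneg)

text \<open>Expand the square and apply Chapman--Kolmogorov with the symmetry of the walk.
  Truncation at \<open>T\<close> comes first because convergence of the Green series is itself
  deduced from this bound, with \<open>R\<close> a single site.\<close>

lemma sum_partial_green_sq_le:
  assumes "finite R"
  shows "(\<Sum>x\<in>R. (\<Sum>n<T. step_prob n (x :: int ^ 'd))\<^sup>2) \<le> green_sq_bound TYPE('d)"
proof -
  have "(\<Sum>x\<in>R. (\<Sum>n<T. step_prob n x)\<^sup>2)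
      = (\<Sum>x\<in>R. \<Sum>j<T. \<Sum>k<T. step_prob j x * step_prob k x)"
    by (simp add: power2_eq_square sum_product)
  also have "\<dots> = (\<Sum>j<T. \<Sum>k<T. \<Sum>x\<in>R. step_prob j x * step_prob k x)"
    by (subst sum.swap, intro sum.cong refl, rule sum.swap)
  also have "\<dots> \<le> (\<Sum>j<T. \<Sum>k<T. step_prob (j + k) (0 :: int ^ 'd))"
    using assms by (intro sum_mono step_prob_inner_le)
  also have "\<dots> \<le> (\<Sum>n<2 * T. real (Suc n) * step_prob n (0 :: int ^ 'd))"
    by (intro sum_sum_add_le step_prob_nonneg)
  also have "\<dots> \<le> green_sq_bound TYPE('d)"
    unfolding green_sq_bound_def
    by (intro sum_le_suminf summable_return_prob dim) (auto simp: step_prob_nonneg)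
  finally show ?thesis .
qed

lemma summable_step_prob: "summable (\<lambda>n. step_prob n (x :: int ^ 'd))"
proof (rule summableI_nonneg_bounded)
  fix T
  show "(\<Sum>n<T. step_prob n x) \<le> sqrt (green_sq_bound TYPE('d))"
    using sum_partial_green_sq_le[of "{x}" T] by (intro real_le_rsqrt) simp
qed (rule step_prob_nonneg)

lemma green_real_nonneg: "0 \<le> green_real (x :: int ^ 'd)"
  unfolding green_real_def by (intro suminf_nonneg summable_step_prob step_prob_nonneg)

lemma green_real_zero_ge_1: "1 \<le> green_real (0 :: int ^ 'd)"
  using sum_le_suminf[OF summable_step_prob, of "{0}" 0]
  by (simp add: green_real_def step_prob_nonneg)

lemma sum_green_real_sq_le:
  assumes "finite R"
  shows "(\<Sum>x\<in>R. (green_real (x :: int ^ 'd))\<^sup>2) \<le> green_sq_bound TYPE('d)"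
proof (rule LIMSEQ_le_const2)
  show "(\<lambda>T. \<Sum>x\<in>R. (\<Sum>n<T. step_prob n x)\<^sup>2) \<longlonglongrightarrow> (\<Sum>x\<in>R. (green_real x)\<^sup>2)"
    unfolding green_real_def
    by (intro tendsto_sum tendsto_power summable_LIMSEQ summable_step_prob)
qed (use sum_partial_green_sq_le[OF assms] in blast)

text \<open>Averaging over one step shifts the series by one time unit, which loses exactly the term
  at time 0.\<close>

lemma step_avg_green_real:
  "step_avg (\<lambda>s. green_real (x + s :: int ^ 'd)) = green_real x - of_bool (x = 0)"
proof -
  have "step_avg (\<lambda>s. green_real (x + s)) = step_avg (\<lambda>s. green_real (x - s))"
    using step_avg_uminus[of "\<lambda>s. green_real (x - s)"] by simp
  also have "\<dots> = (\<Sum>n. step_prob (Suc n) x)"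
    unfolding green_real_def by (subst step_avg_suminf) (auto simp: summable_step_prob)
  also have "\<dots> = green_real x - step_prob 0 x"
    unfolding green_real_def by (rule suminf_split_head[OF summable_step_prob])
  finally show ?thesis by simp
qed

text \<open>\<open>R\<close> is a finite set whose sum comes within \<eta> of the supremum over all
  finite sets.\<close>

lemma green_real_small_tail:
  assumes "\<eta> > 0"
  obtains R where "finite R"
    "\<And>F. finite F \<Longrightarrow> F \<inter> R = {} \<Longrightarrow> (\<Sum>x\<in>F. (green_real (x :: int ^ 'd))\<^sup>2) \<le> \<eta>"
proof -
  define S where "S = (\<lambda>F. \<Sum>x\<in>F. (green_real (x :: int ^ 'd))\<^sup>2)"
  have bdd: "bdd_above (S ` Collect finite)"
    using sum_green_real_sq_le unfolding S_def by (intro bdd_aboveI2) auto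
  have "Sup (S ` Collect finite) - \<eta> < Sup (S ` Collect finite)" using assms by simp
  then obtain R where R: "finite R" "Sup (S ` Collect finite) - \<eta> < S R"
    using less_cSUP_iff[OF _ bdd] by (metis empty_iff finite.emptyI mem_Collect_eq)
  show thesis
  proof (rule that[OF R(1)])
    fix F assume F: "finite F" "F \<inter> R = {}"
    have "S F + S R = S (F \<union> R)"
      unfolding S_def using F R by (simp add: sum.union_disjoint)
    also have "\<dots> \<le> Sup (S ` Collect finite)"
      using F R by (intro cSUP_upper bdd) auto
    finally show "(\<Sum>x\<in>F. (green_real x)\<^sup>2) \<le> \<eta>" using R unfolding S_def by simp
  qed
qed

end

section \<open>Visits and the first step decomposition\<close>

text \<open>Unlike \<open>local_time\<close>, this omits time \<open>n\<close>, so that zero visits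
  give the empty profile and inductions on \<open>n\<close> start there.\<close>

definition visits :: "(nat \<Rightarrow> int ^ 'd::finite) \<Rightarrow> nat \<Rightarrow> int ^ 'd \<Rightarrow> nat" where
  "visits \<omega> n x = (\<Sum>k<n. of_bool (walk \<omega> k = x))"

lemma local_time_eq_visits: "local_time \<omega> n = visits \<omega> (Suc n)"
  by (auto simp: local_time_def visits_def lessThan_Suc_atMost)

lemma walk_case_nat: "walk (case_nat s \<omega>) (Suc k) = s + walk \<omega> k"
  unfolding walk_def by (subst sum.lessThan_Suc_shift) simp

lemma visits_case_nat:
  "visits (case_nat s \<omega>) (Suc n) x = of_bool (x = 0) + visits \<omega> n (x - s)"
proof -
  have "walk (case_nat s \<omega>) 0 = 0" by (simp add: walk_def)
  moreover have "s + walk \<omega> k = x \<longleftrightarrow> walk \<omega> k = x - s" for k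
    by (auto simp: algebra_simps)
  ultimately show ?thesis
    unfolding visits_def by (subst sum.lessThan_Suc_shift) (auto simp: walk_case_nat)
qed

lemma finite_visits: "finite {x. visits \<omega> n x \<noteq> 0}"
proof (rule finite_subset)
  show "{x. visits \<omega> n x \<noteq> 0} \<subseteq> walk \<omega> ` {..<n}" by (auto simp: visits_def)
qed auto

section \<open>The law of the walk: measurability and first step\<close>

lemma sequence_space_steps: "sequence_space (measure_pmf (pmf_of_set unit_steps))"
  by (simp add: sequence_space_def product_prob_space_def product_prob_space_axioms_def
      product_sigma_finite_def measure_pmf.sigma_finite_measure_axioms measure_pmf.prob_space_axioms)

lemma prob_space_srw: "prob_space (srw_measure :: (nat \<Rightarrow> int ^ 'd::finite) measure)"
  unfolding srw_measure_def by (intro prob_space_PiM measure_pmf.prob_space_axioms)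

lemma space_srw [simp]: "space srw_measure = UNIV"
  unfolding srw_measure_def by (simp add: space_PiM)

lemma measurable_step: "(\<lambda>\<omega>. \<omega> k) \<in> measurable srw_measure (count_space UNIV)"
proof -
  have "(\<lambda>\<omega>. \<omega> k) \<in> measurable srw_measure (measure_pmf (pmf_of_set unit_steps))"
    unfolding srw_measure_def by (rule measurable_component_singleton) simp
  then show ?thesis by (simp cong: measurable_cong_sets)
qed

lemma measurable_walk:
  "(\<lambda>\<omega>. walk \<omega> n) \<in> measurable srw_measure (count_space (UNIV :: (int ^ 'd::finite) set))"
proof (induction n)
  case (Suc n)
  have "(\<lambda>\<omega>. x + \<omega> n) \<in> measurable srw_measure (count_space (UNIV :: (int ^ 'd) set))" for x
    by (rule measurable_compose[OF measurable_step]) simp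
  from measurable_compose_countable[OF this Suc] show ?case
    by (simp add: walk_def)
qed (simp add: walk_def)

text \<open>\<open>P\<close> is an arbitrary predicate on profiles: conditioning on the countably
  valued last position moves the last visit into \<open>P\<close>.\<close>

lemma measurable_visits: "(\<lambda>\<omega>. P (visits \<omega> n)) \<in> measurable srw_measure (count_space UNIV)"
proof (induction n arbitrary: P)
  case 0
  show ?case by (simp add: visits_def)
next
  case (Suc n)
  have e: "visits \<omega> (Suc n) = (\<lambda>x. visits \<omega> n x + of_bool (walk \<omega> n = x))"
    for \<omega> :: "nat \<Rightarrow> int ^ 'a"
    by (auto simp: visits_def)
  show ?case
    unfolding e
    by (rule measurable_compose_countable[OF Suc[of "\<lambda>L. P (\<lambda>x. L x + of_bool (w = x))" for w] measurable_walk])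
qed

lemma sets_visits: "{\<omega>. P (visits \<omega> n)} \<in> sets srw_measure"
  using measurable_sets[OF measurable_visits, of "{True}" P n] by (simp add: vimage_def)

text \<open>Prepending an independent uniform step to the sequence of steps preserves the product
  measure.\<close>

lemma prob_first_step:
  fixes A :: "(nat \<Rightarrow> int ^ 'd::finite) set"
  assumes A: "A \<in> sets srw_measure"
  shows "measure srw_measure A = step_avg (\<lambda>s. measure srw_measure {\<omega>. case_nat s \<omega> \<in> A})"
proof -
  define M where "M = measure_pmf (pmf_of_set (unit_steps :: (int ^ 'd) set))"
  interpret sequence_space M unfolding M_def by (rule sequence_space_steps)
  interpret S: prob_space srw_measure by (rule prob_space_srw)
  have srw: "(srw_measure :: (nat \<Rightarrow> int ^ 'd) measure) = PiM UNIV (\<lambda>_. M)"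
    unfolding srw_measure_def M_def by simp
  let ?f = "\<lambda>(s, \<omega>). case_nat s \<omega> :: nat \<Rightarrow> int ^ 'd"
  have f: "?f \<in> measurable (M \<Otimes>\<^sub>M srw_measure) srw_measure"
    unfolding srw by measurable
  have "emeasure srw_measure A = emeasure (distr (M \<Otimes>\<^sub>M srw_measure) srw_measure ?f) A"
    unfolding srw by (subst PiM_iter) simp
  also have "\<dots> = emeasure (M \<Otimes>\<^sub>M srw_measure) (?f -` A \<inter> space (M \<Otimes>\<^sub>M srw_measure))"
    by (rule emeasure_distr[OF f A])
  also have "\<dots> = (\<integral>\<^sup>+ s. emeasure srw_measure (Pair s -` (?f -` A \<inter> space (M \<Otimes>\<^sub>M srw_measure))) \<partial>M)"
    by (rule S.emeasure_pair_measure_alt) (rule measurable_sets[OF f A])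
  also have "\<dots> = (\<integral>\<^sup>+ s. emeasure srw_measure {\<omega>. case_nat s \<omega> \<in> A} \<partial>M)"
    by (intro nn_integral_cong arg_cong[where f = "emeasure srw_measure"])
      (auto simp: space_pair_measure M_def)
  also have "\<dots> = (\<Sum>s\<in>unit_steps. emeasure srw_measure {\<omega>. case_nat s \<omega> \<in> A})
      / card (unit_steps :: (int ^ 'd) set)"
    unfolding M_def by (intro nn_integral_pmf_of_set unit_steps_nonempty finite_unit_steps)
  also have "\<dots> = ennreal (step_avg (\<lambda>s. measure srw_measure {\<omega>. case_nat s \<omega> \<in> A}))"
    unfolding step_avg_def card_unit_steps S.emeasure_eq_measure ennreal_of_nat_eq_real_of_nat
    by (simp add: sum_nonneg divide_ennreal)
  finally show ?thesis
    unfolding S.emeasure_eq_measure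
    by (subst (asm) ennreal_inj) (auto simp: step_avg_def intro!: sum_nonneg divide_nonneg_nonneg)
qed

lemma prob_walk_eq: "measure srw_measure {\<omega>. walk \<omega> n = x} = step_prob n x"
proof (induction n arbitrary: x)
  case 0
  interpret S: prob_space srw_measure by (rule prob_space_srw)
  show ?case using S.prob_space by (auto simp: walk_def)
next
  case (Suc n)
  have "{\<omega>. walk \<omega> (Suc n) = x} \<in> sets srw_measure"
    using measurable_sets[OF measurable_walk, of "{x}" "Suc n"] by (simp add: vimage_def)
  then have "measure srw_measure {\<omega>. walk \<omega> (Suc n) = x}
      = step_avg (\<lambda>s. measure srw_measure {\<omega>. walk (case_nat s \<omega>) (Suc n) = x})"
    by (subst prob_first_step) auto
  also have "\<dots> = step_avg (\<lambda>s. measure srw_measure {\<omega>. walk \<omega> n = x - s})"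
    by (simp add: walk_case_nat algebra_simps)
  also have "\<dots> = step_prob (Suc n) x" by (simp add: Suc)
  finally show ?case .
qed

lemma green_eq_green_real:
  assumes "CARD('d::finite) \<ge> 5"
  shows "green (x :: int ^ 'd) = ennreal (green_real x)"
proof -
  interpret S: prob_space srw_measure by (rule prob_space_srw)
  have m: "{\<omega>. walk \<omega> k = x} \<in> sets srw_measure" for k
    using measurable_sets[OF measurable_walk, of "{x}" k] by (simp add: vimage_def)
  have "green x = (\<integral>\<^sup>+ \<omega>. (\<Sum>k. indicator {\<omega>. walk \<omega> k = x} \<omega>) \<partial>srw_measure)"
    unfolding green_def total_local_time_def
    by (intro nn_integral_cong suminf_cong) (auto simp: indicator_def)
  also have "\<dots> = (\<Sum>k. emeasure srw_measure {\<omega>. walk \<omega> k = x})"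
    using m by (subst nn_integral_suminf) auto
  also have "\<dots> = (\<Sum>k. ennreal (step_prob k x))"
    by (simp add: S.emeasure_eq_measure prob_walk_eq)
  also have "\<dots> = ennreal (green_real x)"
    unfolding green_real_def
    by (intro suminf_ennreal2 step_prob_nonneg summable_step_prob assms)
  finally show ?thesis .
qed

section \<open>Exponential bounds for functionals of the local times\<close>

text \<open>One supermartingale step: \<open>f\<close> is collected while the mean potential passes
  from \<Phi> to at most \<open>\<Phi> - f + c\<close>. The bound \<open>1 + v \<le> exp v\<close>
  is applied to the relative change \<open>\<theta> * (c - f) / u\<close> of
  \<open>u = 1 + \<theta> * \<Phi>\<close>.\<close>

lemma khasminskii_step:
  fixes \<alpha> \<theta> \<Phi> \<Phi>' f c B :: real
  assumes "0 \<le> \<alpha>" "\<alpha> * B < 1" "0 \<le> \<Phi>" "\<Phi> \<le> B" "0 \<le> f" "0 \<le> c"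
    and \<theta>: "\<theta> = \<alpha> / (1 - \<alpha> * B)"
    and step: "\<Phi>' \<le> \<Phi> - f + c"
  shows "exp (\<alpha> * f) * (1 + \<theta> * \<Phi>') \<le> exp (\<theta> * c) * (1 + \<theta> * \<Phi>)"
proof -
  have \<theta>0: "0 \<le> \<theta>" using assms by simp
  define u where "u = 1 + \<theta> * \<Phi>"
  have u: "u \<ge> 1" using \<theta>0 assms unfolding u_def by simp
  \<comment> \<open>\<theta> is the solution of
    \<open>\<alpha> * (1 + \<theta> * B) = \<theta>\<close>, hence the collected amount is paid for
    whenever the potential is at most \<open>B\<close>.\<close>
  have "\<alpha> * u \<le> \<alpha> + \<alpha> * (\<theta> * B)"
    using mult_left_mono[OF mult_left_mono[OF \<open>\<Phi> \<le> B\<close> \<theta>0] \<open>0 \<le> \<alpha>\<close>]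
    unfolding u_def by (simp add: distrib_left)
  also have "\<dots> = \<theta>" using assms unfolding \<theta> by (simp add: field_simps)
  finally have "\<alpha> \<le> \<theta> / u" using u by (simp add: field_simps)
  then have lf: "\<alpha> * f \<le> \<theta> * f / u"
    using mult_right_mono[of \<alpha> "\<theta> / u" f] assms by simp
  have uc: "\<theta> * c / u \<le> \<theta> * c"
    using divide_left_mono[OF u, of "\<theta> * c"] u \<theta>0 \<open>0 \<le> c\<close> by simp
  have "1 + \<theta> * \<Phi>' \<le> u + \<theta> * (c - f)"
    using mult_left_mono[OF step \<theta>0] unfolding u_def by (simp add: algebra_simps)
  also have "\<dots> = u * (1 + \<theta> * (c - f) / u)" using u by (simp add: field_simps)
  also have "\<dots> \<le> u * exp (\<theta> * (c - f) / u)" using u by (intro mult_left_mono exp_ge_add_one_self) auto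
  also have "\<dots> \<le> u * exp (\<theta> * c - \<alpha> * f)"
    using u lf uc by (intro mult_left_mono) (auto simp: right_diff_distrib diff_divide_distrib)
  finally have "exp (\<alpha> * f) * (1 + \<theta> * \<Phi>') \<le> exp (\<alpha> * f) * (u * exp (\<theta> * c - \<alpha> * f))"
    by (intro mult_left_mono) auto
  also have "\<dots> = exp (\<theta> * c) * u" by (simp add: exp_diff)
  finally show ?thesis unfolding u_def .
qed

text \<open>\<open>drift\<close> says that at a visit the mean change of the potential,
  \<open>G 0 * (h (Suc l) - h l) - h (Suc l)\<close>, is at most
  \<open>c - \<kappa> * h (Suc l)\<close>: all but \<open>c\<close> of the collected amount is
  compensated.\<close>

locale occupation_functional =
  fixes h :: "nat \<Rightarrow> real" and \<kappa> c :: real and dim_type :: "'d::finite itself"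
  assumes dim: "CARD('d) \<ge> 5"
    and h_zero: "h 0 = 0"
    and h_mono: "h l \<le> h (Suc l)"
    and h_Suc: "h (Suc l) \<le> h l + 1"
    and \<kappa>_pos: "0 < \<kappa>" and c_nonneg: "0 \<le> c"
    and drift: "\<kappa> * h (Suc l) + green_real (0 :: int ^ 'd) * (h (Suc l) - h l) \<le> h (Suc l) + c"
begin

definition site_weight :: "nat \<Rightarrow> real" where
  "site_weight l = \<kappa> * (\<Sum>j<l. h (Suc j))"

definition weight :: "(int ^ 'd \<Rightarrow> nat) \<Rightarrow> real" where
  "weight L = (\<Sum>x | L x \<noteq> 0. site_weight (L x))"

definition potential :: "int ^ 'd \<Rightarrow> (int ^ 'd \<Rightarrow> nat) \<Rightarrow> real" where
  "potential z L = (\<Sum>x | L x \<noteq> 0. h (L x) * green_real (z - x))"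

lemma h_nonneg: "0 \<le> h l"
  by (induction l) (auto simp: h_zero intro: order_trans[OF _ h_mono])

lemma site_weight_nonneg: "0 \<le> site_weight l"
  unfolding site_weight_def using \<kappa>_pos by (simp add: sum_nonneg h_nonneg)

text \<open>A discrete form of integrating \<open>(h^2)' \<le> 2 h\<close>, valid since increments
  of \<open>h\<close> are at most 1.\<close>

lemma h_sq_le: "(h l)\<^sup>2 \<le> 2 / \<kappa> * site_weight l"
proof (induction l)
  case (Suc l)
  have "(h (Suc l))\<^sup>2 - (h l)\<^sup>2 = (h (Suc l) - h l) * (h (Suc l) + h l)"
    by (simp add: power2_eq_square algebra_simps)
  also have "\<dots> \<le> 1 * (2 * h (Suc l))"
    using h_mono[of l] h_Suc[of l] h_nonneg[of l] by (intro mult_mono) auto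
  finally show ?case using Suc \<kappa>_pos by (simp add: site_weight_def)
qed (simp add: h_zero site_weight_def)

lemma sum_h_sq_le: "(\<Sum>x | L x \<noteq> 0. (h (L x))\<^sup>2) \<le> 2 / \<kappa> * weight L"
  unfolding weight_def sum_distrib_left by (intro sum_mono h_sq_le)

lemma potential_nonneg: "0 \<le> potential z L"
  unfolding potential_def by (intro sum_nonneg mult_nonneg_nonneg h_nonneg green_real_nonneg dim)

lemma weight_visit:
  assumes "finite {x. L x \<noteq> 0}"
  shows "weight (L(z := Suc (L z))) = weight L + \<kappa> * h (Suc (L z))"
proof -
  define D where "D = insert z {x. L x \<noteq> 0}"
  have D: "finite D" "z \<in> D" using assms unfolding D_def by auto
  have w: "weight K = (\<Sum>x\<in>D. site_weight (K x))" if "{x. K x \<noteq> 0} \<subseteq> D" for K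
    unfolding weight_def using D that
    by (intro sum.mono_neutral_left) (auto simp: site_weight_def)
  have "weight (L(z := Suc (L z))) = (\<Sum>x\<in>D. site_weight (if x = z then Suc (L z) else L x))"
    by (subst w) (auto simp: D_def)
  also have "\<dots> = site_weight (Suc (L z)) + (\<Sum>x\<in>D - {z}. site_weight (L x))"
    using D by (simp add: sum.remove cong: sum.cong_simp)
  also have "\<dots> = weight L + \<kappa> * h (Suc (L z))"
  proof -
    have "weight L = site_weight (L z) + (\<Sum>x\<in>D - {z}. site_weight (L x))"
      using w[of L] sum.remove[OF D, of "\<lambda>x. site_weight (L x)"] by (auto simp: D_def)
    then show ?thesis by (simp add: site_weight_def algebra_simps)
  qed
  finally show ?thesis .
qed

text \<open>By harmonicity, averaging over the step after the visit only subtracts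
  \<open>h (Suc (L z))\<close>, at the site \<open>x = z\<close>; \<open>drift\<close> bounds the
  result.\<close>

lemma step_avg_potential_visit:
  assumes "finite {x. L x \<noteq> 0}"
  shows "step_avg (\<lambda>s. potential (z + s) (L(z := Suc (L z))))
    \<le> potential z L - \<kappa> * h (Suc (L z)) + c"
proof -
  let ?L' = "L(z := Suc (L z))"
  define D where "D = insert z {x. L x \<noteq> 0}"
  have D: "finite D" "z \<in> D" using assms unfolding D_def by auto
  have p: "potential y K = (\<Sum>x\<in>D. h (K x) * green_real (y - x))" if "{x. K x \<noteq> 0} \<subseteq> D" for y K
    unfolding potential_def using D that
    by (intro sum.mono_neutral_left) (auto simp: h_zero)
  have L': "{x. ?L' x \<noteq> 0} \<subseteq> D" unfolding D_def by auto
  have "step_avg (\<lambda>s. potential (z + s) ?L')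
      = (\<Sum>x\<in>D. h (?L' x) * step_avg (\<lambda>s. green_real (z - x + s)))"
    unfolding p[OF L'] step_avg_sum step_avg_cmult by (simp add: algebra_simps)
  also have "\<dots> = (\<Sum>x\<in>D. h (?L' x) * (green_real (z - x) - of_bool (z - x = 0)))"
    by (simp only: step_avg_green_real[OF dim])
  also have "\<dots> = h (Suc (L z)) * (green_real (0 :: int ^ 'd) - 1)
      + (\<Sum>x\<in>D - {z}. h (L x) * green_real (z - x))"
    using D by (subst sum.remove[of D z]) (auto intro!: sum.cong)
  also have "\<dots> = potential z L - h (L z) * green_real (0 :: int ^ 'd)
      + h (Suc (L z)) * (green_real (0 :: int ^ 'd) - 1)"
    using D by (subst p) (auto simp: D_def sum.remove[of _ z])
  also have "\<dots> \<le> potential z L - \<kappa> * h (Suc (L z)) + c"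
    using drift[of "L z"] by (simp add: algebra_simps)
  finally show ?thesis .
qed

text \<open>The process \<open>exp (\<alpha> W) (1 + \<theta> \<Phi>) exp (- \<theta> c n)\<close>, with \<open>W\<close> the weight and \<open>\<Phi>\<close> the
  potential, is a supermartingale as long as \<open>\<Phi> \<le> B\<close>; this is unrolled by backward induction
  on the remaining number of visits, from an arbitrary initial occupation profile \<open>L\<close>.\<close>

lemma prob_weight_ge_aux:
  fixes z :: "int ^ 'd"
  assumes "0 \<le> \<alpha>" "\<alpha> * B < 1"
    and \<theta>: "\<theta> = \<alpha> / (1 - \<alpha> * B)"
    and B: "\<And>z L. finite {x. L x \<noteq> 0} \<Longrightarrow> weight L < a \<Longrightarrow> potential z L \<le> B"
    and "finite {x. L x \<noteq> 0}"
  shows "measure srw_measure {\<omega>. a \<le> weight (\<lambda>x. L x + visits \<omega> n (x - z))}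
    \<le> exp (\<alpha> * (weight L - a) + \<theta> * c * real n) * (1 + \<theta> * potential z L)"
  using assms(5)
proof (induction n arbitrary: z L)
  interpret S: prob_space "srw_measure :: (nat \<Rightarrow> int ^ 'd) measure" by (rule prob_space_srw)
  have \<theta>0: "0 \<le> \<theta>" using assms by simp
  \<comment> \<open>Once the weight has reached \<open>a\<close> the bound is at least 1. This acts
    as stopping, so the step below uses \<open>B\<close> only at weights under
    \<open>a\<close>.\<close>
  have trivial: "measure srw_measure A \<le> exp (\<alpha> * (weight L - a) + \<theta> * c * real n) * (1 + \<theta> * potential z L)"
    if "a \<le> weight L" for A :: "(nat \<Rightarrow> int ^ 'd) set" and n z L
  proof -
    have "1 * 1 \<le> exp (\<alpha> * (weight L - a) + \<theta> * c * real n) * (1 + \<theta> * potential z L)"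
      using that \<theta>0 assms c_nonneg potential_nonneg[of z L] by (intro mult_mono) auto
    then show ?thesis using S.prob_le_1[of A] by linarith
  qed
  {
    case 0
    show ?case
    proof (cases "a \<le> weight L")
      case False
      then show ?thesis using \<theta>0 potential_nonneg[of z L] by (simp add: visits_def)
    qed (rule trivial)
  next
    case (Suc n)
    let ?L' = "L(z := Suc (L z))"
    have fin: "finite {x. ?L' x \<noteq> 0}"
      by (rule finite_subset[of _ "insert z {x. L x \<noteq> 0}"]) (use Suc.prems in auto)
    show ?case
    proof (cases "a \<le> weight L")
      case False
      let ?A = "{\<omega>. a \<le> weight (\<lambda>x. L x + visits \<omega> (Suc n) (x - z))}"
      let ?e = "\<lambda>w. exp (\<alpha> * (w - a) + \<theta> * c * real n)"
      \<comment> \<open>After the first step, a fresh walk starts at \<open>z + s\<close> on the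
        profile in which \<open>z\<close> has one more visit.\<close>
      have shift: "(\<lambda>x. L x + visits (case_nat s \<omega>) (Suc n) (x - z))
          = (\<lambda>x. ?L' x + visits \<omega> n (x - (z + s)))" for s \<omega>
        by (auto simp: visits_case_nat algebra_simps)
      have "measure srw_measure ?A = step_avg (\<lambda>s. measure srw_measure {\<omega>. case_nat s \<omega> \<in> ?A})"
        by (rule prob_first_step) (rule sets_visits[of "\<lambda>v. a \<le> weight (\<lambda>x. L x + v (x - z))"])
      also have "\<dots> = step_avg (\<lambda>s. measure srw_measure
          {\<omega>. a \<le> weight (\<lambda>x. ?L' x + visits \<omega> n (x - (z + s)))})"
        unfolding mem_Collect_eq shift ..
      also have "\<dots> \<le> step_avg (\<lambda>s. ?e (weight ?L') * (1 + \<theta> * potential (z + s) ?L'))"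
        by (intro step_avg_mono Suc.IH fin)
      also have "\<dots> = ?e (weight ?L') * (1 + \<theta> * step_avg (\<lambda>s. potential (z + s) ?L'))"
        by (simp only: step_avg_cmult step_avg_add step_avg_const)
      also have "\<dots> = ?e (weight L) * (exp (\<alpha> * (\<kappa> * h (Suc (L z))))
          * (1 + \<theta> * step_avg (\<lambda>s. potential (z + s) ?L')))"
        unfolding weight_visit[OF Suc.prems] by (simp add: algebra_simps flip: exp_add)
      also have "\<dots> \<le> ?e (weight L) * (exp (\<theta> * c) * (1 + \<theta> * potential z L))"
      proof (intro mult_left_mono khasminskii_step[where B = B])
        show "step_avg (\<lambda>s. potential (z + s) ?L') \<le> potential z L - \<kappa> * h (Suc (L z)) + c"
          by (rule step_avg_potential_visit[OF Suc.prems])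
        show "potential z L \<le> B" using False Suc.prems by (intro B) auto
      qed (use assms c_nonneg \<kappa>_pos h_nonneg potential_nonneg in auto)
      also have "\<dots> = exp (\<alpha> * (weight L - a) + \<theta> * c * real (Suc n)) * (1 + \<theta> * potential z L)"
        by (simp add: algebra_simps flip: exp_add)
      finally show ?thesis .
    qed (rule trivial)
  }
qed

lemma prob_weight_ge:
  assumes "0 \<le> \<alpha>" "\<alpha> * B < 1"
    and B: "\<And>z L. finite {x. L x \<noteq> 0} \<Longrightarrow> weight L < a \<Longrightarrow> potential z L \<le> B"
  shows "measure srw_measure {\<omega>. a \<le> weight (visits \<omega> n)}
    \<le> exp (\<alpha> / (1 - \<alpha> * B) * c * real n - \<alpha> * a)"
  using prob_weight_ge_aux[OF assms(1,2) refl B, where L = "\<lambda>_. 0" and n = n and z = 0]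
  by (simp add: weight_def potential_def)

text \<open>Cauchy--Schwarz together with \<open>sum_h_sq_le\<close>; the subset \<open>D\<close>
  serves both the whole profile and its part far from \<open>z\<close>.\<close>

lemma sum_h_green_real_le:
  assumes L: "finite {x. L x \<noteq> 0}" "D \<subseteq> {x. L x \<noteq> 0}"
    and \<eta>: "(\<Sum>x\<in>D. (green_real (z - x))\<^sup>2) \<le> \<eta>"
  shows "(\<Sum>x\<in>D. h (L x) * green_real (z - x)) \<le> sqrt (\<eta> * (2 / \<kappa> * weight L))"
proof (rule real_le_rsqrt)
  have D: "finite D" using L finite_subset by blast
  have "(\<Sum>x\<in>D. h (L x) * green_real (z - x))\<^sup>2
      \<le> (\<Sum>x\<in>D. (h (L x))\<^sup>2) * (\<Sum>x\<in>D. (green_real (z - x))\<^sup>2)"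
    by (rule Cauchy_Schwarz_ineq_sum)
  also have "\<dots> \<le> (2 / \<kappa> * weight L) * \<eta>"
  proof (intro mult_mono \<eta>)
    have "(\<Sum>x\<in>D. (h (L x))\<^sup>2) \<le> (\<Sum>x | L x \<noteq> 0. (h (L x))\<^sup>2)"
      using L by (intro sum_mono2) auto
    also have "\<dots> \<le> 2 / \<kappa> * weight L" by (rule sum_h_sq_le)
    finally show "(\<Sum>x\<in>D. (h (L x))\<^sup>2) \<le> 2 / \<kappa> * weight L" .
    show "0 \<le> 2 / \<kappa> * weight L"
      using \<kappa>_pos by (simp add: weight_def sum_nonneg site_weight_nonneg)
  qed (auto intro: sum_nonneg)
  finally show "(\<Sum>x\<in>D. h (L x) * green_real (z - x))\<^sup>2 \<le> \<eta> * (2 / \<kappa> * weight L)"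
    by (simp only: mult.commute)
qed

lemma potential_le:
  assumes "finite {x. L x \<noteq> 0}"
  shows "potential z L \<le> sqrt (green_sq_bound TYPE('d) * (2 / \<kappa> * weight L))"
  unfolding potential_def
proof (rule sum_h_green_real_le[OF assms order_refl])
  have "(\<Sum>x | L x \<noteq> 0. (green_real (z - x))\<^sup>2) = (\<Sum>y\<in>(\<lambda>x. z - x) ` {x. L x \<noteq> 0}. (green_real y)\<^sup>2)"
    by (subst sum.reindex) (auto simp: inj_on_def)
  also have "\<dots> \<le> green_sq_bound TYPE('d)"
    using assms by (intro sum_green_real_sq_le dim) auto
  finally show "(\<Sum>x | L x \<noteq> 0. (green_real (z - x))\<^sup>2) \<le> green_sq_bound TYPE('d)" .
qed

text \<open>Sites with \<open>z - x\<close> in \<open>R\<close> are bounded by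
  \<open>h \<le> M\<close>, the others by Cauchy--Schwarz with the small tail \<eta>.\<close>

lemma potential_le_tail:
  assumes L: "finite {x. L x \<noteq> 0}" and "finite R" and M: "\<And>l. h l \<le> M"
    and R: "\<And>F. finite F \<Longrightarrow> F \<inter> R = {} \<Longrightarrow> (\<Sum>x\<in>F. (green_real (x :: int ^ 'd))\<^sup>2) \<le> \<eta>"
  shows "potential z L \<le> M * (\<Sum>y\<in>R. green_real y) + sqrt (\<eta> * (2 / \<kappa> * weight L))"
proof -
  define D where "D = {x. L x \<noteq> 0 \<and> z - x \<in> R}"
  define E where "E = {x. L x \<noteq> 0 \<and> z - x \<notin> R}"
  have fin: "finite D" "finite E" using L by (auto simp: D_def E_def elim: rev_finite_subset)
  have "potential z L = (\<Sum>x\<in>D \<union> E. h (L x) * green_real (z - x))"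
    unfolding potential_def by (intro sum.cong) (auto simp: D_def E_def)
  also have "\<dots> = (\<Sum>x\<in>D. h (L x) * green_real (z - x)) + (\<Sum>x\<in>E. h (L x) * green_real (z - x))"
    using fin by (intro sum.union_disjoint) (auto simp: D_def E_def)
  also have "(\<Sum>x\<in>D. h (L x) * green_real (z - x)) \<le> (\<Sum>x\<in>D. M * green_real (z - x))"
    by (intro sum_mono mult_right_mono M green_real_nonneg dim)
  also have "\<dots> = M * (\<Sum>y\<in>(\<lambda>x. z - x) ` D. green_real y)"
    by (subst sum.reindex) (auto simp: inj_on_def sum_distrib_left)
  also have "\<dots> \<le> M * (\<Sum>y\<in>R. green_real y)"
    using M[of 0] h_zero \<open>finite R\<close>
    by (intro mult_left_mono sum_mono2) (auto simp: D_def green_real_nonneg[OF dim])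
  also have "(\<Sum>x\<in>E. h (L x) * green_real (z - x)) \<le> sqrt (\<eta> * (2 / \<kappa> * weight L))"
  proof (rule sum_h_green_real_le[OF L])
    have "(\<Sum>x\<in>E. (green_real (z - x))\<^sup>2) = (\<Sum>y\<in>(\<lambda>x. z - x) ` E. (green_real y)\<^sup>2)"
      by (subst sum.reindex) (auto simp: inj_on_def)
    also have "\<dots> \<le> \<eta>"
      using fin by (intro R) (auto simp: E_def)
    finally show "(\<Sum>x\<in>E. (green_real (z - x))\<^sup>2) \<le> \<eta>" .
  qed (auto simp: E_def)
  finally show ?thesis by simp
qed

lemma sq_local_time_le_weight:
  assumes "0 \<le> C" and A: "\<And>x. x \<in> A \<Longrightarrow> (real (local_time \<omega> n x))\<^sup>2 \<le> C * (h (local_time \<omega> n x))\<^sup>2"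
  shows "sq_local_time \<omega> n (A :: (int ^ 'd) set) \<le> 2 * C / \<kappa> * weight (visits \<omega> (Suc n))"
proof -
  let ?L = "visits \<omega> (Suc n)"
  have fin: "finite {x. ?L x \<noteq> 0}" by (rule finite_visits)
  have "sq_local_time \<omega> n A = (\<Sum>\<^sub>\<infinity>x\<in>A \<inter> {x. ?L x \<noteq> 0}. (real (?L x))\<^sup>2)"
    unfolding sq_local_time_def local_time_eq_visits by (intro infsum_cong_neutral) auto
  also have "\<dots> = (\<Sum>x\<in>A \<inter> {x. ?L x \<noteq> 0}. (real (?L x))\<^sup>2)"
    using fin by simp
  also have "\<dots> \<le> (\<Sum>x\<in>A \<inter> {x. ?L x \<noteq> 0}. C * (h (?L x))\<^sup>2)"
    using A unfolding local_time_eq_visits by (intro sum_mono) auto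
  also have "\<dots> \<le> (\<Sum>x | ?L x \<noteq> 0. C * (h (?L x))\<^sup>2)"
    using fin \<open>0 \<le> C\<close> by (intro sum_mono2) auto
  also have "\<dots> \<le> C * (2 / \<kappa> * weight ?L)"
    unfolding sum_distrib_left[symmetric] using \<open>0 \<le> C\<close> by (intro mult_left_mono sum_h_sq_le)
  finally show ?thesis by (simp add: mult_ac)
qed

text \<open>The squared local times on \<open>A\<close> are at most \<open>2 * C / \<kappa>\<close>
  times the weight, so the event forces the weight up to \<open>\<kappa> * t / (2 * C)\<close>.
  Times 0 to \<open>n\<close> make \<open>Suc n\<close> visits.\<close>

lemma prob_sq_local_time_ge:
  fixes A :: "(nat \<Rightarrow> int ^ 'd) \<Rightarrow> (int ^ 'd) set"
  assumes "0 < C"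
    and A: "\<And>\<omega> x. x \<in> A \<omega> \<Longrightarrow> (real (local_time \<omega> n x))\<^sup>2 \<le> C * (h (local_time \<omega> n x))\<^sup>2"
    and "0 \<le> \<alpha>" "\<alpha> * B < 1"
    and B: "\<And>z L. finite {x. L x \<noteq> 0} \<Longrightarrow> weight L < \<kappa> * t / (2 * C) \<Longrightarrow> potential z L \<le> B"
  shows "\<P>(\<omega> in srw_measure. sq_local_time \<omega> n (A \<omega>) \<ge> t)
    \<le> exp (\<alpha> / (1 - \<alpha> * B) * c * real (Suc n) - \<alpha> * (\<kappa> * t / (2 * C)))"
proof -
  interpret S: prob_space "srw_measure :: (nat \<Rightarrow> int ^ 'd) measure" by (rule prob_space_srw)
  have "\<P>(\<omega> in srw_measure. sq_local_time \<omega> n (A \<omega>) \<ge> t)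
      \<le> measure srw_measure {\<omega>. \<kappa> * t / (2 * C) \<le> weight (visits \<omega> (Suc n))}"
  proof (rule S.finite_measure_mono)
    show "{\<omega> \<in> space srw_measure. t \<le> sq_local_time \<omega> n (A \<omega>)}
        \<subseteq> {\<omega>. \<kappa> * t / (2 * C) \<le> weight (visits \<omega> (Suc n))}"
    proof (clarsimp)
      fix \<omega> assume "t \<le> sq_local_time \<omega> n (A \<omega>)"
      also have "\<dots> \<le> 2 * C / \<kappa> * weight (visits \<omega> (Suc n))"
        using A \<open>0 < C\<close> by (intro sq_local_time_le_weight) auto
      finally show "\<kappa> * t / (2 * C) \<le> weight (visits \<omega> (Suc n))"
        using \<open>0 < C\<close> \<kappa>_pos by (simp add: field_simps)
    qed
  qed (rule sets_visits)
  also have "\<dots> \<le> exp (\<alpha> / (1 - \<alpha> * B) * c * real (Suc n) - \<alpha> * (\<kappa> * t / (2 * C)))"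
    by (rule prob_weight_ge[OF assms(3,4) B])
  finally show ?thesis .
qed

end

section \<open>Low and high levels\<close>

lemma limsup_ext_ln_le:
  assumes "\<And>n. 0 \<le> p n" and "eventually (\<lambda>n. p n \<le> exp (- K * sqrt (real n))) sequentially"
  shows "limsup (\<lambda>n. ereal (1 / sqrt (real n)) * ext_ln (p n)) \<le> - ereal K"
proof (rule Limsup_bounded)
  show "eventually (\<lambda>n. ereal (1 / sqrt (real n)) * ext_ln (p n) \<le> - ereal K) sequentially"
    \<comment> \<open>For \<open>n > 0\<close> the prefactor is positive, so a vanishing probability
      gives minus infinity and not 0.\<close>
    using assms(2) eventually_gt_at_top[of 0]
  proof eventually_elim
    case (elim n)
    show ?case
    proof (cases "p n = 0")
      case False
      then have "0 < p n" using assms(1)[of n] by simp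
      then have "ln (p n) \<le> - K * sqrt (real n)"
        using elim by (metis ln_exp ln_le_cancel_iff exp_gt_zero)
      then show ?thesis using False elim by (simp add: ext_ln_def field_simps)
    qed (use elim in \<open>simp add: ext_ln_def\<close>)
  qed
qed

context
  assumes dim: "CARD('d::finite) \<ge> 5"
begin

text \<open>With \<open>h l = min l M\<close>, \<open>\<kappa> = 1\<close>, \<open>C = 1\<close> and
  drift \<open>g\<close> per step, the weight must reach \<open>n * y / 2\<close>, at least
  \<open>(g + 1/2) * n\<close>. The corrections cost at most \<open>n / 4\<close>, and the remaining
  surplus \<open>n / 4\<close> times \<open>\<alpha> = 4 * K / sqrt n\<close> is
  \<open>K * sqrt n\<close>.\<close>

lemma eventually_prob_low_levels:
  assumes "\<epsilon> > 0" and y: "2 * green_real (0 :: int ^ 'd) + 1 \<le> y" and "K > 0"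
  shows "eventually (\<lambda>n. \<P>(\<omega> in (srw_measure :: (nat \<Rightarrow> int ^ 'd) measure).
      sq_local_time \<omega> n {x. real (local_time \<omega> n x) \<le> real n powr (1 / 2 - \<epsilon>)} \<ge> real n * y)
    \<le> exp (- K * sqrt (real n))) sequentially"
proof -
  define g where "g = green_real (0 :: int ^ 'd)"
  have g: "1 \<le> g" unfolding g_def by (rule green_real_zero_ge_1[OF dim])
  have y0: "0 < y" using y g unfolding g_def by simp
  \<comment> \<open>\<rho> will bound \<open>\<alpha> * B\<close>; it is so small that the factor
    \<open>1 / (1 - \<rho>)\<close> raises the drift by at most 1/8.\<close>
  define \<rho> where "\<rho> = 1 / (16 * g)"
  have \<rho>: "0 < \<rho>" "\<rho> \<le> 1 / 2" using g unfolding \<rho>_def by (auto simp: field_simps)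
  have g\<rho>: "g / (1 - \<rho>) \<le> g + 1 / 8"
  proof -
    have "g \<le> (g + 1 / 8) * (1 - \<rho>)" using g unfolding \<rho>_def by (simp add: field_simps)
    then show ?thesis using \<rho> by (simp add: field_simps)
  qed
  \<comment> \<open>Chosen so that
    \<open>\<alpha> * sqrt (\<eta> * (n * y)) = \<rho> / 2\<close>.\<close>
  define \<eta> where "\<eta> = (\<rho> / (8 * K))\<^sup>2 / y"
  have "0 < \<eta>" using \<rho> y0 \<open>K > 0\<close> unfolding \<eta>_def by simp
  from green_real_small_tail[OF dim this] obtain R where R: "finite R"
    "\<And>F. finite F \<Longrightarrow> F \<inter> R = {} \<Longrightarrow> (\<Sum>x\<in>F. (green_real (x :: int ^ 'd))\<^sup>2) \<le> \<eta>"
    by blast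
  define S where "S = (\<Sum>x\<in>R. green_real x)"
  have S: "0 \<le> S" unfolding S_def by (intro sum_nonneg green_real_nonneg dim)
  \<comment> \<open>This is \<open>\<alpha> * (M * S)\<close>, the share of the sites near the walk,
    which vanishes in the limit.\<close>
  have "(\<lambda>n. 4 * K * S * real n powr (- \<epsilon>)) \<longlonglongrightarrow> 4 * K * S * 0"
    using \<open>\<epsilon> > 0\<close>
    by (intro tendsto_mult tendsto_const tendsto_neg_powr filterlim_real_sequentially) auto
  then have "eventually (\<lambda>n. 4 * K * S * real n powr (- \<epsilon>) < \<rho> / 2) sequentially"
    using \<rho> by (intro order_tendstoD) auto
  \<comment> \<open>Large \<open>n\<close> absorbs the extra visit of \<open>Suc n\<close> into
    another 1/8 of drift.\<close>
  moreover have "eventually (\<lambda>n. 8 * (g + 1 / 8) \<le> real n) sequentially"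
    using filterlim_real_sequentially unfolding filterlim_at_top by blast
  ultimately show ?thesis
  proof eventually_elim
    case (elim n)
    then have n: "0 < n" "8 * (g + 1 / 8) \<le> real n" using g by (auto intro: Nat.gr0I)
    define M where "M = real n powr (1 / 2 - \<epsilon>)"
    define h where "h l = min (real l) M" for l
    define \<alpha> where "\<alpha> = 4 * K / sqrt (real n)"
    define B where "B = M * S + sqrt (\<eta> * (real n * y))"
    have M: "0 \<le> M" unfolding M_def by simp
    interpret occupation_functional h 1 g "TYPE('d)"
      by unfold_locales (use dim g M in \<open>auto simp: h_def g_def min_def mult_left_le\<close>)
    have \<alpha>: "0 < \<alpha>" using n \<open>K > 0\<close> unfolding \<alpha>_def by simp
    have "\<alpha> * (M * S) = 4 * K * S * (real n powr (1 / 2 - \<epsilon>) / real n powr (1 / 2))"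
      unfolding \<alpha>_def M_def by (simp add: powr_half_sqrt)
    also have "\<dots> < \<rho> / 2" using elim by (simp flip: powr_diff)
    finally have "\<alpha> * (M * S) < \<rho> / 2" .
    moreover have "\<alpha> * sqrt (\<eta> * (real n * y)) = \<rho> / 2"
      using n y0 \<rho> \<open>K > 0\<close> unfolding \<alpha>_def \<eta>_def by (simp add: real_sqrt_mult real_sqrt_divide)
    ultimately have \<alpha>B: "\<alpha> * B \<le> \<rho>" unfolding B_def by (simp add: distrib_left)
    have "\<P>(\<omega> in (srw_measure :: (nat \<Rightarrow> int ^ 'd) measure).
        sq_local_time \<omega> n {x. real (local_time \<omega> n x) \<le> M} \<ge> real n * y)
      \<le> exp (\<alpha> / (1 - \<alpha> * B) * g * real (Suc n) - \<alpha> * (1 * (real n * y) / (2 * 1)))"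
    proof (rule prob_sq_local_time_ge)
      fix z :: "int ^ 'd" and L
      assume L: "finite {x. L x \<noteq> 0}" "weight L < 1 * (real n * y) / (2 * 1)"
      have "potential z L \<le> M * S + sqrt (\<eta> * (2 / 1 * weight L))"
        unfolding S_def using R by (intro potential_le_tail L) (auto simp: h_def)
      also have "\<dots> \<le> B"
        unfolding B_def using L \<open>0 < \<eta>\<close> by simp
      finally show "potential z L \<le> B" .
    qed (use \<alpha> \<alpha>B \<rho> in \<open>auto simp: h_def\<close>)
    also have "\<dots> \<le> exp (- K * sqrt (real n))"
    proof -
      have "\<alpha> / (1 - \<alpha> * B) * g * real (Suc n) \<le> \<alpha> / (1 - \<rho>) * g * real (Suc n)"
        using \<alpha> \<alpha>B \<rho> g by (intro mult_right_mono divide_left_mono mult_pos_pos) auto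
      also have "\<dots> = \<alpha> * (g / (1 - \<rho>) * real (Suc n))" by simp
      also have "\<dots> \<le> \<alpha> * ((g + 1 / 8) * real (Suc n))"
        using \<alpha> by (intro mult_left_mono mult_right_mono g\<rho>) auto
      also have "\<dots> \<le> \<alpha> * ((g + 1 / 4) * real n)"
      proof (rule mult_left_mono)
        have "(g + 1 / 8) * real (Suc n) = (g + 1 / 8) * real n + (g + 1 / 8)"
          by (simp add: algebra_simps)
        also have "\<dots> \<le> (g + 1 / 8) * real n + real n / 8" using n by (intro add_left_mono) simp
        also have "\<dots> = (g + 1 / 4) * real n" by (simp add: algebra_simps)
        finally show "(g + 1 / 8) * real (Suc n) \<le> (g + 1 / 4) * real n" .
      qed (use \<alpha> in simp)
      finally have "\<alpha> / (1 - \<alpha> * B) * g * real (Suc n) - \<alpha> * (real n * y / 2)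
          \<le> \<alpha> * ((g + 1 / 4) * real n - real n * y / 2)"
        by (simp add: algebra_simps)
      also have "\<dots> \<le> \<alpha> * (- real n / 4)"
      proof (rule mult_left_mono)
        have "real n * (2 * g + 1) \<le> real n * y"
          using y unfolding g_def by (intro mult_left_mono) auto
        then show "(g + 1 / 4) * real n - real n * y / 2 \<le> - real n / 4"
          by (simp add: algebra_simps)
      qed (use \<alpha> in simp)
      also have "\<dots> = - K * (real n / sqrt (real n))" unfolding \<alpha>_def by simp
      also have "\<dots> = - K * sqrt (real n)" by (simp add: real_div_sqrt)
      finally show ?thesis by simp
    qed
    finally show ?case unfolding M_def .
  qed
qed

text \<open>Here \<open>\<kappa> = 1/2\<close>, and \<open>l > M\<close> implies
  \<open>l \<le> 2 * h l\<close>, so \<open>C = 4\<close> and the weight must reach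
  \<open>n * y / 16\<close>.\<close>

lemma eventually_prob_high_levels:
  assumes "y > 0" "\<epsilon> < 1 / 2"
  shows "\<exists>K>0. eventually (\<lambda>n. \<P>(\<omega> in (srw_measure :: (nat \<Rightarrow> int ^ 'd) measure).
      sq_local_time \<omega> n {x. real (local_time \<omega> n x) > real n powr (1 / 2 - \<epsilon>)} \<ge> real n * y)
    \<le> exp (- K * sqrt (real n))) sequentially"
proof -
  define g where "g = green_real (0 :: int ^ 'd)"
  have g: "1 \<le> g" unfolding g_def by (rule green_real_zero_ge_1[OF dim])
  \<comment> \<open>The drift \<open>\<delta> * g\<close>, doubled once by
    \<open>1 / (1 - \<alpha> * B)\<close> and once by \<open>Suc n \<le> 2 * n\<close>, stays below
    half of the required \<open>y / 16\<close> per step.\<close>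
  define \<delta> where "\<delta> = min 1 (y / (128 * g))"
  have \<delta>: "0 < \<delta>" "\<delta> \<le> 1" "128 * (\<delta> * g) \<le> y"
    using g assms unfolding \<delta>_def by (auto simp: min_def field_simps)
  \<comment> \<open>Below weight \<open>n * y / 16\<close>, Cauchy--Schwarz bounds the potential by
    \<open>b * sqrt n\<close>; then \<beta> ensures \<open>\<alpha> * B \<le> 1/2\<close>.\<close>
  define b where "b = sqrt (green_sq_bound TYPE('d) * y / 4)"
  have b: "0 \<le> b" unfolding b_def using green_sq_bound_nonneg[OF dim] assms by simp
  define \<beta> where "\<beta> = 1 / (2 * (b + 1))"
  have \<beta>: "0 < \<beta>" "\<beta> * b \<le> 1 / 2" using b unfolding \<beta>_def by (auto simp: field_simps)
  have "eventually (\<lambda>n. (4 * g / \<delta>) powr (1 / (1 / 2 - \<epsilon>)) \<le> real n) sequentially"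
    using filterlim_real_sequentially unfolding filterlim_at_top by blast
  then have "eventually (\<lambda>n. 4 * g / \<delta> \<le> real n powr (1 / 2 - \<epsilon>)) sequentially"
  proof eventually_elim
    case (elim n)
    have "((4 * g / \<delta>) powr (1 / (1 / 2 - \<epsilon>))) powr (1 / 2 - \<epsilon>) \<le> real n powr (1 / 2 - \<epsilon>)"
      using elim assms by (intro powr_mono2) auto
    then show ?case using assms g \<delta> by (simp add: powr_powr)
  qed
  then have "eventually (\<lambda>n. \<P>(\<omega> in (srw_measure :: (nat \<Rightarrow> int ^ 'd) measure).
      sq_local_time \<omega> n {x. real (local_time \<omega> n x) > real n powr (1 / 2 - \<epsilon>)} \<ge> real n * y)
    \<le> exp (- (\<beta> * y / 32) * sqrt (real n))) sequentially"
    using eventually_gt_at_top[of 0]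
  proof eventually_elim
    case (elim n)
    define M where "M = real n powr (1 / 2 - \<epsilon>)"
    define h where "h l = max (real l - M / 2) (\<delta> * real l)" for l
    define \<alpha> where "\<alpha> = \<beta> / sqrt (real n)"
    define B where "B = b * sqrt (real n)"
    have M: "0 \<le> M" "4 * g / \<delta> \<le> M" using elim unfolding M_def by auto
    interpret occupation_functional h "1 / 2" "\<delta> * g" "TYPE('d)"
    proof unfold_locales
      show "h 0 = 0" using M by (simp add: h_def)
      fix l
      show mono: "h l \<le> h (Suc l)" using \<delta> by (auto simp: h_def algebra_simps)
      show inc: "h (Suc l) \<le> h l + 1" using \<delta> by (auto simp: h_def max_def algebra_simps)
      show "1 / 2 * h (Suc l) + green_real (0 :: int ^ 'd) * (h (Suc l) - h l) \<le> h (Suc l) + \<delta> * g"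
      \<comment> \<open>If \<open>h (Suc l)\<close> is at least \<open>2 * g\<close>, half of it
        pays for an increment of 1. Otherwise \<open>M \<ge> 4 * g / \<delta>\<close> puts
        \<open>Suc l\<close> below \<open>M / 2\<close>, where \<open>h\<close> has slope \<delta>
        and the increment costs only \<open>\<delta> * g\<close>.\<close>
      proof (cases "2 * g \<le> \<delta> * real (Suc l)")
        case True
        then have "2 * g \<le> h (Suc l)" by (simp add: h_def)
        moreover have "g * (h (Suc l) - h l) \<le> g * 1" using inc g by (intro mult_left_mono) auto
        moreover have "0 \<le> \<delta> * g" using \<delta> g by simp
        ultimately show ?thesis unfolding g_def by simp
      next
        case False
        then have "\<delta> * real (Suc l) \<le> \<delta> * (M / 2)" using M \<delta> by (simp add: field_simps)
        then have "real (Suc l) \<le> M / 2" using \<delta> by simp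
        then have "h (Suc l) = \<delta> * real (Suc l)" "h l = \<delta> * real l"
          using \<delta> by (auto simp: h_def max_def mult_less_0_iff intro: order_antisym
              order_trans[of _ 0])
        then have "h (Suc l) - h l = \<delta>" "0 \<le> h (Suc l)" using \<delta> by (auto simp: algebra_simps)
        then show ?thesis unfolding g_def by simp
      qed
    qed (use dim \<delta> g in auto)
    have \<alpha>: "0 < \<alpha>" using elim \<beta> unfolding \<alpha>_def by simp
    have \<alpha>B: "\<alpha> * B \<le> 1 / 2" using \<beta> elim unfolding \<alpha>_def B_def by simp
    have "\<P>(\<omega> in (srw_measure :: (nat \<Rightarrow> int ^ 'd) measure).
        sq_local_time \<omega> n {x. real (local_time \<omega> n x) > M} \<ge> real n * y)
      \<le> exp (\<alpha> / (1 - \<alpha> * B) * (\<delta> * g) * real (Suc n) - \<alpha> * (1 / 2 * (real n * y) / (2 * 4)))"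
    proof (rule prob_sq_local_time_ge)
      fix z :: "int ^ 'd" and L
      assume L: "finite {x. L x \<noteq> 0}" "weight L < 1 / 2 * (real n * y) / (2 * 4)"
      have "potential z L \<le> sqrt (green_sq_bound TYPE('d) * (2 / (1 / 2) * weight L))"
        by (rule potential_le[OF L(1)])
      also have "\<dots> \<le> sqrt (green_sq_bound TYPE('d) * (real n * y / 4))"
        using L(2) green_sq_bound_nonneg[OF dim] by (intro real_sqrt_le_mono mult_left_mono) auto
      also have "\<dots> = B"
        unfolding B_def b_def by (simp flip: real_sqrt_mult)
      finally show "potential z L \<le> B" .
    next
      fix \<omega> and x :: "int ^ 'd" assume "x \<in> {x. real (local_time \<omega> n x) > M}"
      then have "M < real (local_time \<omega> n x)" by simp
      moreover have "real (local_time \<omega> n x) - M / 2 \<le> h (local_time \<omega> n x)"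
        unfolding h_def by (rule max.cobounded1)
      ultimately have "real (local_time \<omega> n x) \<le> 2 * h (local_time \<omega> n x)" by linarith
      then have "(real (local_time \<omega> n x))\<^sup>2 \<le> (2 * h (local_time \<omega> n x))\<^sup>2"
        by (intro power_mono) auto
      then show "(real (local_time \<omega> n x))\<^sup>2 \<le> 4 * (h (local_time \<omega> n x))\<^sup>2"
        by (simp add: power_mult_distrib)
    qed (use \<alpha> \<alpha>B in auto)
    also have "\<dots> \<le> exp (- (\<beta> * y / 32) * sqrt (real n))"
    proof -
      have "\<alpha> / (1 - \<alpha> * B) \<le> \<alpha> / (1 / 2)"
        using \<alpha> \<alpha>B by (intro divide_left_mono mult_pos_pos) auto
      then have "\<alpha> / (1 - \<alpha> * B) * ((\<delta> * g) * real (Suc n)) \<le> (2 * \<alpha>) * ((\<delta> * g) * (2 * real n))"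
        using \<alpha> \<alpha>B \<delta> g elim by (intro mult_mono) auto
      also have "\<dots> = \<alpha> * real n * (128 * (\<delta> * g)) / 32" by simp
      also have "\<dots> \<le> \<alpha> * real n * y / 32"
        using \<alpha> \<delta> by (intro divide_right_mono mult_left_mono) auto
      finally have "\<alpha> / (1 - \<alpha> * B) * (\<delta> * g) * real (Suc n) \<le> \<alpha> * real n * y / 32"
        by (simp only: mult.assoc)
      moreover have "\<alpha> * (1 / 2 * (real n * y) / (2 * 4)) = 2 * (\<alpha> * real n * y / 32)" by simp
      ultimately have "\<alpha> / (1 - \<alpha> * B) * (\<delta> * g) * real (Suc n)
          - \<alpha> * (1 / 2 * (real n * y) / (2 * 4)) \<le> - (\<alpha> * real n * y / 32)"
        by linarith
      also have "\<dots> = - (\<beta> * y / 32) * (real n / sqrt (real n))"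
        unfolding \<alpha>_def by (simp add: mult_ac)
      also have "\<dots> = - (\<beta> * y / 32) * sqrt (real n)" by (simp only: real_div_sqrt of_nat_0_le_iff)
      finally show ?thesis by simp
    qed
    finally show ?case unfolding M_def .
  qed
  moreover have "0 < \<beta> * y / 32" using \<beta> assms by simp
  ultimately show ?thesis by blast
qed

end

text \<open>The second part takes \<open>\<epsilon> < 1/2\<close>: for
  \<open>\<epsilon> > 1/2\<close> and \<open>n \<ge> 2\<close> the threshold is below 1, every
  visited site counts, and the sum is at least \<open>n + 1\<close>, so the event is certain when
  \<open>y \<le> 1\<close>.\<close>

theorem proposition1p5:
  assumes "CARD('d::finite) \<ge> 5"
  shows
    "(\<forall>\<epsilon>>0. \<forall>y::real. 1 + 2 * (\<Sum>\<^sub>\<infinity>x::int ^ 'd. (green x)\<^sup>2) < ennreal y \<longrightarrow>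
        limsup (\<lambda>n. ereal (1 / sqrt (real n)) *
          ext_ln \<P>(\<omega> in (srw_measure :: (nat \<Rightarrow> int ^ 'd) measure).
            sq_local_time \<omega> n {x. real (local_time \<omega> n x) \<le> real n powr (1 / 2 - \<epsilon>)}
              \<ge> real n * y)) = -\<infinity>)
     \<and> (\<forall>y>0. \<forall>\<epsilon>>0. \<epsilon> < 1 / 2 \<longrightarrow> (\<exists>c>0.
        limsup (\<lambda>n. ereal (1 / sqrt (real n)) *
          ext_ln \<P>(\<omega> in (srw_measure :: (nat \<Rightarrow> int ^ 'd) measure).
            sq_local_time \<omega> n {x. real (local_time \<omega> n x) > real n powr (1 / 2 - \<epsilon>)}
              \<ge> real n * y)) \<le> - ereal c))"
proof (intro conjI allI impI)
  fix \<epsilon> y :: real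
  assume \<epsilon>: "0 < \<epsilon>" and y: "1 + 2 * (\<Sum>\<^sub>\<infinity>x::int ^ 'd. (green x)\<^sup>2) < ennreal y"
  define g where "g = green_real (0 :: int ^ 'd)"
  have g: "1 \<le> g" unfolding g_def by (rule green_real_zero_ge_1[OF assms])
  \<comment> \<open>The origin alone contributes \<open>g^2 \<ge> g\<close> to the sum, which gives
    the condition \<open>2 * g + 1 \<le> y\<close> of the low level estimate.\<close>
  have "(\<Sum>\<^sub>\<infinity>x\<in>{0 :: int ^ 'd}. (green x)\<^sup>2) \<le> (\<Sum>\<^sub>\<infinity>x::int ^ 'd. (green x)\<^sup>2)"
    by (rule infsum_mono_neutral) (auto intro: nonneg_summable_on_complete)
  then have "1 + 2 * (green (0 :: int ^ 'd))\<^sup>2 \<le> 1 + 2 * (\<Sum>\<^sub>\<infinity>x::int ^ 'd. (green x)\<^sup>2)"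
    by (intro add_left_mono mult_left_mono) auto
  also note y
  also have "1 + 2 * (green (0 :: int ^ 'd))\<^sup>2 = ennreal (1 + 2 * g\<^sup>2)"
    unfolding green_eq_green_real[OF assms] g_def
    by (simp add: green_real_nonneg[OF assms] ennreal_power ennreal_mult)
  finally have "1 + 2 * g\<^sup>2 < y" by (simp add: ennreal_less_iff del: ennreal_plus)
  moreover have "g \<le> g\<^sup>2" using g by (simp add: power2_eq_square)
  ultimately have le: "2 * green_real (0 :: int ^ 'd) + 1 \<le> y" unfolding g_def by simp
  let ?l = "limsup (\<lambda>n. ereal (1 / sqrt (real n)) *
          ext_ln \<P>(\<omega> in (srw_measure :: (nat \<Rightarrow> int ^ 'd) measure).
            sq_local_time \<omega> n {x. real (local_time \<omega> n x) \<le> real n powr (1 / 2 - \<epsilon>)}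
              \<ge> real n * y))"
  have "?l \<le> - ereal K" if "K > 0" for K
    by (intro limsup_ext_ln_le eventually_prob_low_levels assms \<epsilon> le that) simp
  \<comment> \<open>The rate \<open>\<bar>K\<bar> + 1\<close> is positive and puts the limsup below
    any real \<open>K\<close>, of either sign.\<close>
  then have "?l \<le> ereal K" for K
  proof -
    have "?l \<le> - ereal (\<bar>K\<bar> + 1)" by (rule \<open>\<And>K. K > 0 \<Longrightarrow> ?l \<le> - ereal K\<close>) simp
    also have "\<dots> \<le> ereal K" by simp
    finally show ?thesis .
  qed
  then show "?l = - \<infinity>" by (rule ereal_bot)
next
  fix y \<epsilon> :: real
  assume "0 < y" "\<epsilon> < 1 / 2"
  from eventually_prob_high_levels[OF assms this] obtain c where "0 < c" and
    c: "eventually (\<lambda>n. \<P>(\<omega> in (srw_measure :: (nat \<Rightarrow> int ^ 'd) measure).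
      sq_local_time \<omega> n {x. real (local_time \<omega> n x) > real n powr (1 / 2 - \<epsilon>)} \<ge> real n * y)
    \<le> exp (- c * sqrt (real n))) sequentially"
    by blast
  show "\<exists>c>0. limsup (\<lambda>n. ereal (1 / sqrt (real n)) *
          ext_ln \<P>(\<omega> in (srw_measure :: (nat \<Rightarrow> int ^ 'd) measure).
            sq_local_time \<omega> n {x. real (local_time \<omega> n x) > real n powr (1 / 2 - \<epsilon>)}
              \<ge> real n * y)) \<le> - ereal c"
    using \<open>0 < c\<close> limsup_ext_ln_le[OF measure_nonneg c] by blast
qed

end
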